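(* Let $S=\begin{pmatrix}A&B\\C&D\end{pmatrix}\in\mathrm{Sp}(d,\mathbb{R})$ with blocks $A,B,C,D\in\mathbb{R}^{d\times d}$, let $\hat S$ be a metaplectic operator with projection $S$, let $k\in\mathcal{S}'(\mathbb{R}^{2d})$ be its Schwartz kernel, and let $\tilde k=k*\varphi$ be its smoothed kernel, where $\varphi(t)=e^{-\pi|t|^2}$, $t\in\mathbb{R}^{2d}$. If $D=I$, then $k$ is quasi-diagonal. More precisely, $\tilde k$ is localized on the manifold $$\Gamma_S=\{(x,x):x\in\ker(C)\},$$ that is, there exist $c>0$ and a positive semi-definite quadratic form $\mathcal{Q}_S$ on $\mathbb{R}^{2d}$ such that $|\tilde k(x,y)|=c\,e^{-\pi\mathcal{Q}_S(x,y)}$ for all $x,y\in\mathbb{R}^d$ and $\{(x,y)\in\mathbb{R}^{2d}:\mathcal{Q}_S(x,y)=0\}=\{(x,x):x\in\ker(C)\}$.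
   Context: $\mathrm{Sp}(d,\mathbb{R})$ is the group of real $2d\times 2d$ matrices with $d\times d$ blocks $\begin{pmatrix}A&B\\C&D\end{pmatrix}$ satisfying $A^TC=C^TA$, $B^TD=D^TB$, $A^TD-C^TB=I$. Metaplectic operators. For $(x,\xi;\tau)\in\mathbb{R}^d\times\mathbb{R}^d\times\mathbb{R}$ and $f\in L^2(\mathbb{R}^d)$ let $\rho(x,\xi;\tau)f(t)=e^{2\pi i\tau}e^{-i\pi x\cdot\xi}e^{2\pi i\xi\cdot t}f(t-x)$. A metaplectic operator with projection $S$ is a unitary operator $\hat S$ on $L^2(\mathbb{R}^d)$ with $\hat S\rho(x,\xi;\tau)\hat S^{-1}=\rho(S(x,\xi);\tau)$ for all $(x,\xi;\tau)$; it exists and is unique up to a phase factor (a complex constant of modulus $1$). $\hat S$ maps $\mathcal{S}(\mathbb{R}^d)$ to $\mathcal{S}(\mathbb{R}^d)$ continuously. Schwartz kernel. The kernel of a continuous linear $T:\mathcal{S}(\mathbb{R}^d)\to\mathcal{S}'(\mathbb{R}^d)$ is the distribution $k\in\mathcal{S}'(\mathbb{R}^{2d})$ such that, formally, $Tf(x)=\int_{\mathbb{R}^d}k(x,y)f(y)\,dy$ for $f\in\mathcal{S}(\mathbb{R}^d)$. Quasi-diagonality. Let $\langle x\rangle=(1+|x|^2)^{1/2}$. A continuous function $h$ on $\mathbb{R}^{2d}$ is a diagonal kernel if for every integer $N>0$ there is $C_N>0$ with $|h(x,y)|\le C_N\langle x-y\rangle^{-N}$ for all $x,y\in\mathbb{R}^d$.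 A distribution $k\in\mathcal{S}'(\mathbb{R}^{2d})$ is quasi-diagonal if $\tilde k=k*\varphi$ is a diagonal kernel. *)

theory Defs
  imports "HOL-Analysis.Analysis"
begin

definition japanese_bracket :: "'a::real_normed_vector \<Rightarrow> real" where
  "japanese_bracket x = sqrt (1 + (norm x)\<^sup>2)"

definition gaussian :: "'a::real_normed_vector \<Rightarrow> complex" where
  "gaussian t = complex_of_real (exp (- pi * (norm t)\<^sup>2))"

text \<open>Multi-indices are encoded as lists of standard basis vectors, so every mixed partial
  derivative occurs (once for each order of differentiation).\<close>

primrec iterated_partial ::
    "'a::euclidean_space list \<Rightarrow> ('a \<Rightarrow> complex) \<Rightarrow> 'a \<Rightarrow> complex" where
  "iterated_partial [] f = f"
| "iterated_partial (b # bs) f = (\<lambda>x. frechet_derivative (iterated_partial bs f) (at x) b)"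

definition smooth :: "('a::euclidean_space \<Rightarrow> complex) \<Rightarrow> bool" where
  "smooth f \<longleftrightarrow>
     (\<forall>bs. set bs \<subseteq> Basis \<longrightarrow> (\<forall>x. iterated_partial bs f differentiable (at x)))"

definition schwartz_space :: "('a::euclidean_space \<Rightarrow> complex) set" where
  "schwartz_space = {f. smooth f \<and>
     (\<forall>m bs. set bs \<subseteq> Basis \<longrightarrow>
        bdd_above (range (\<lambda>x. japanese_bracket x ^ m * norm (iterated_partial bs f x))))}"

definition schwartz_seminorm ::
    "nat \<Rightarrow> 'a::euclidean_space list \<Rightarrow> ('a \<Rightarrow> complex) \<Rightarrow> real" where
  "schwartz_seminorm m bs f = (SUP x. japanese_bracket x ^ m * norm (iterated_partial bs f x))"

text \<open>A distribution is a functional on all functions of which only the values on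
  \<open>schwartz_space\<close> matter; the pairing is bilinear (no complex conjugation). Continuity is
  stated as domination by finitely many of the seminorms that define the topology.\<close>

definition tempered_distribution :: "(('a::euclidean_space \<Rightarrow> complex) \<Rightarrow> complex) \<Rightarrow> bool" where
  "tempered_distribution u \<longleftrightarrow>
     (\<forall>f\<in>schwartz_space. \<forall>g\<in>schwartz_space. \<forall>a b.
        u (\<lambda>x. a * f x + b * g x) = a * u f + b * u g) \<and>
     (\<exists>K N. \<forall>f\<in>schwartz_space.
        norm (u f) \<le>
          K * (\<Sum>m\<le>N. \<Sum>bs\<in>{bs. set bs \<subseteq> Basis \<and> length bs \<le> N}. schwartz_seminorm m bs f))"

definition function_distribution ::
    "('a::euclidean_space \<Rightarrow> complex) \<Rightarrow> ('a \<Rightarrow> complex) \<Rightarrow> complex" where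
  "function_distribution h g = (LINT x|lborel. h x * g x)"

definition distribution_convolution ::
    "(('a::euclidean_space \<Rightarrow> complex) \<Rightarrow> complex) \<Rightarrow> ('a \<Rightarrow> complex) \<Rightarrow> 'a \<Rightarrow> complex" where
  "distribution_convolution u \<phi> z = u (\<lambda>w. \<phi> (z - w))"

text \<open>The formal identity \<open>T f x = \<integral> k (x, y) f y dy\<close> in weak form, tested against
  \<open>g\<close>. Here \<open>T f\<close> is itself a distribution.\<close>

definition is_schwartz_kernel ::
    "(('a::euclidean_space \<Rightarrow> complex) \<Rightarrow> ('a \<Rightarrow> complex) \<Rightarrow> complex) \<Rightarrow>
     (('a \<times> 'a \<Rightarrow> complex) \<Rightarrow> complex) \<Rightarrow> bool" where
  "is_schwartz_kernel T k \<longleftrightarrow> tempered_distribution k \<and>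
     (\<forall>f\<in>schwartz_space. \<forall>g\<in>schwartz_space. k (\<lambda>(x, y). g x * f y) = T f g)"

text \<open>Elements of the Hilbert space \<open>L\<^sup>2\<close> are handled through representatives; an operator acts
  on representatives, and all its properties are required up to null sets.\<close>

definition L2_space :: "('a::euclidean_space \<Rightarrow> complex) set" where
  "L2_space = {f. f \<in> borel_measurable lborel \<and> integrable lborel (\<lambda>x. (norm (f x))\<^sup>2)}"

definition unitary_L2 :: "(('a::euclidean_space \<Rightarrow> complex) \<Rightarrow> ('a \<Rightarrow> complex)) \<Rightarrow> bool" where
  "unitary_L2 T \<longleftrightarrow>
     (\<forall>f\<in>L2_space. T f \<in> L2_space) \<and>
     (\<forall>f\<in>L2_space. \<forall>g\<in>L2_space.
        (AE x in lborel. f x = g x) \<longrightarrow> (AE x in lborel. T f x = T g x)) \<and>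
     (\<forall>f\<in>L2_space. \<forall>g\<in>L2_space. \<forall>a b.
        AE x in lborel. T (\<lambda>y. a * f y + b * g y) x = a * T f x + b * T g x) \<and>
     (\<forall>f\<in>L2_space. \<forall>g\<in>L2_space.
        (LINT x|lborel. T f x * cnj (T g x)) = (LINT x|lborel. f x * cnj (g x))) \<and>
     (\<forall>g\<in>L2_space. \<exists>f\<in>L2_space. AE x in lborel. T f x = g x)"

definition schroedinger_rep ::
    "real^'n \<Rightarrow> real^'n \<Rightarrow> real \<Rightarrow> (real^'n \<Rightarrow> complex) \<Rightarrow> real^'n \<Rightarrow> complex" where
  "schroedinger_rep x \<xi> \<tau> f t =
     exp (2 * pi * \<i> * \<tau>) * exp (- \<i> * pi * (x \<bullet> \<xi>)) * exp (2 * pi * \<i> * (\<xi> \<bullet> t)) * f (t - x)"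

text \<open>A \<open>2d \<times> 2d\<close> matrix is given by its four \<open>d \<times> d\<close> blocks; it acts on phase
  space by \<open>(x, \<xi>) \<mapsto> (A x + B \<xi>, C x + D \<xi>)\<close>.\<close>

definition symplectic ::
    "real^'n^'n \<Rightarrow> real^'n^'n \<Rightarrow> real^'n^'n \<Rightarrow> real^'n^'n \<Rightarrow> bool" where
  "symplectic A B C D \<longleftrightarrow>
     transpose A ** C = transpose C ** A \<and>
     transpose B ** D = transpose D ** B \<and>
     transpose A ** D - transpose C ** B = mat 1"

text \<open>The relation \<open>T \<rho>(z; \<tau>) T\<inverse> = \<rho>(S z; \<tau>)\<close>, composed with the bijection \<open>T\<close> on the right.\<close>

definition metaplectic_operator ::
    "real^'n^'n \<Rightarrow> real^'n^'n \<Rightarrow> real^'n^'n \<Rightarrow> real^'n^'n \<Rightarrow>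
     ((real^'n \<Rightarrow> complex) \<Rightarrow> (real^'n \<Rightarrow> complex)) \<Rightarrow> bool" where
  "metaplectic_operator A B C D T \<longleftrightarrow> unitary_L2 T \<and>
     (\<forall>x \<xi> \<tau>. \<forall>f\<in>L2_space. AE t in lborel.
        T (schroedinger_rep x \<xi> \<tau> f) t =
        schroedinger_rep (A *v x + B *v \<xi>) (C *v x + D *v \<xi>) \<tau> (T f) t)"

definition diagonal_kernel ::
    "('a::real_normed_vector \<times> 'a \<Rightarrow> complex) \<Rightarrow> bool" where
  "diagonal_kernel h \<longleftrightarrow> continuous_on UNIV h \<and>
     (\<forall>N::nat. N > 0 \<longrightarrow>
        (\<exists>K>0. \<forall>x y. norm (h (x, y)) \<le> K * japanese_bracket (x - y) powr (- real N)))"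

definition smoothed_kernel ::
    "(('a::euclidean_space \<times> 'a \<Rightarrow> complex) \<Rightarrow> complex) \<Rightarrow> 'a \<times> 'a \<Rightarrow> complex" where
  "smoothed_kernel k = distribution_convolution k gaussian"

definition quasi_diagonal ::
    "(('a::euclidean_space \<times> 'a \<Rightarrow> complex) \<Rightarrow> complex) \<Rightarrow> bool" where
  "quasi_diagonal k \<longleftrightarrow> tempered_distribution k \<and> diagonal_kernel (smoothed_kernel k)"

definition quadratic_form :: "('a::real_vector \<Rightarrow> real) \<Rightarrow> bool" where
  "quadratic_form Q \<longleftrightarrow> (\<exists>\<beta>. bilinear \<beta> \<and> (\<forall>z. Q z = \<beta> z z))"

definition psd_quadratic_form :: "('a::real_vector \<Rightarrow> real) \<Rightarrow> bool" where
  "psd_quadratic_form Q \<longleftrightarrow> quadratic_form Q \<and> (\<forall>z. Q z \<ge> 0)"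

end

(* The smoothed kernel at (x, y) is the matrix coefficient of T g_y against g_x, where g_c is the
   Gaussian centred at c. Von Neumann's identity writes |<f, g_x>|^2 as a Gaussian average over phase
   space of the coefficients <rho(z) f, f>. For f = T g_y the intertwining relation turns these into
   <rho(S^-1 z) g_y, g_y>, which is an explicit Gaussian; the explicit form of T is never needed. So
   |k~(x, y)|^2 is the Fourier transform of exp(-pi/2 (|z|^2 + |S^-1 z|^2)) at a point depending
   linearly on (x, y), again a Gaussian. That point vanishes iff C y = 0 and x = y, and it controls
   |x - y|, which gives both the zero set and the decay. *)

theory Submission
  imports Defs "HOL-Complex_Analysis.Complex_Analysis" "HOL-Probability.Distributions"
begin

subsection \<open>Gaussian integrals\<close>

text \<open>A metaplectic operator is fixed by S only up to a phase, and the coefficients <rho(z) T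
  g, T g> are blind to that phase; this is why the modulus of the kernel can be computed without a
  formula for T. For general D the second component of S^-1 (p, q) is -C^T p + A^T q, so the centres
  x, y of the Gaussians produce the frequency (-C y, A y - x), which vanishes when y is in ker C and
  x = A y. With D = I the symplectic relations make B and C symmetric and give A = I + B C, so A is
  the identity on ker C; this places the zero set on the diagonal. The same identity reads A y - x =
  (y - x) + B (C y), whence |x - y| is bounded by the frequency. With J z = (z, S^-1 z) and L (x, y)
  the frequency, the resulting form is Q = L . (J* J)^-1 L. A formula for the modulus says nothing
  about continuity of the complex-valued smoothed kernel, which a diagonal kernel must have. That is
  obtained separately, from continuity of translation in L^2.\<close>

lemma
  fixes f :: "'a::euclidean_space \<Rightarrow> 'b::{banach, second_countable_topology}"
  assumes [measurable]: "f \<in> borel_measurable borel"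
  shows integrable_lborel_translate: "integrable lborel (\<lambda>x. f (c + x)) \<longleftrightarrow> integrable lborel f"
    and integral_lborel_translate: "(LINT x|lborel. f (c + x)) = (LINT x|lborel. f x)"
proof -
  show "integrable lborel (\<lambda>x. f (c + x)) \<longleftrightarrow> integrable lborel f"
    using integrable_distr_eq[of "(+) c" lborel borel f] by (simp add: lborel_distr_plus)
  show "(LINT x|lborel. f (c + x)) = (LINT x|lborel. f x)"
    using integral_distr[of "(+) c" lborel borel f] by (simp add: lborel_distr_plus)
qed

lemma lborel_distr_reflect:
  fixes c :: "'a::euclidean_space"
  shows "distr lborel borel (\<lambda>x. c - x) = lborel"
  by (subst lborel_affine[of "-1" c]) (auto simp: density_1)

lemma
  fixes f :: "'a::euclidean_space \<Rightarrow> 'b::{banach, second_countable_topology}"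
  assumes [measurable]: "f \<in> borel_measurable borel"
  shows integrable_lborel_reflect: "integrable lborel (\<lambda>x. f (c - x)) \<longleftrightarrow> integrable lborel f"
    and integral_lborel_reflect: "(LINT x|lborel. f (c - x)) = (LINT x|lborel. f x)"
proof -
  show "integrable lborel (\<lambda>x. f (c - x)) \<longleftrightarrow> integrable lborel f"
    using integrable_distr_eq[of "\<lambda>x. c - x" lborel borel f] by (simp add: lborel_distr_reflect)
  show "(LINT x|lborel. f (c - x)) = (LINT x|lborel. f x)"
    using integral_distr[of "\<lambda>x. c - x" lborel borel f] by (simp add: lborel_distr_reflect)
qed

text \<open>The integrand is a product over the coordinates of one-dimensional Gaussians, each a
  multiple of the normal density with variance 1 / (2a).\<close>

lemma integrable_exp_neg_square_norm:
  assumes "a > 0"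
  shows "integrable lborel (\<lambda>x::'a::euclidean_space. exp (- a * (norm x)\<^sup>2))"
proof (rule integrableI_bounded)
  let ?s = "1 / sqrt (2 * a)"
  have *: "exp (- a * x\<^sup>2) = sqrt (2 * pi * ?s\<^sup>2) * normal_density 0 ?s x" for x
    using assms by (simp add: normal_density_def power_divide field_simps)
  have int: "integrable lborel (\<lambda>x::real. exp (- a * x\<^sup>2))"
    unfolding * using assms by (intro integrable_mult_right integrable_normal_density) auto
  have eq: "ennreal (norm (exp (- a * (norm x)\<^sup>2))) = (\<Prod>b\<in>Basis. ennreal (exp (- a * (x \<bullet> b)\<^sup>2)))"
    for x :: 'a
    unfolding power2_norm_eq_inner euclidean_inner[of x x]
    by (simp add: prod_ennreal abs_prod sum_distrib_left exp_sum power2_eq_square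
          flip: sum_negf)
  have "(\<integral>\<^sup>+x. ennreal (norm (exp (- a * (norm (x::'a))\<^sup>2))) \<partial>lborel)
      = (\<Prod>b\<in>(Basis::'a set). \<integral>\<^sup>+x. ennreal (exp (- a * x\<^sup>2)) \<partial>lborel)"
    unfolding eq by (rule nn_integral_lborel_prod) auto
  also have "\<dots> < \<infinity>"
    using int by (simp add: integrable_iff_bounded power_less_top_ennreal)
  finally show "(\<integral>\<^sup>+x. ennreal (norm (exp (- a * (norm (x::'a))\<^sup>2))) \<partial>lborel) < \<infinity>" .
qed simp

text \<open>An injective linear map in finite dimension satisfies B |z| \<le> |J z| for some B > 0,
  so a round Gaussian dominates the integrand.\<close>

lemma integrable_exp_neg_square_norm_linear:
  fixes J :: "'a::euclidean_space \<Rightarrow> 'b::euclidean_space"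
  assumes "a > 0" "linear J" "inj J"
  shows "integrable lborel (\<lambda>z. exp (- a * (norm (J z))\<^sup>2))"
proof -
  obtain B where B: "B > 0" "\<And>x. B * norm x \<le> norm (J x)"
    using linear_inj_bounded_below_pos assms by blast
  have [measurable]: "J \<in> borel_measurable borel"
    using assms linear_continuous_on linear_linear borel_measurable_continuous_onI by blast
  show ?thesis
  proof (rule Bochner_Integration.integrable_bound)
    show "integrable lborel (\<lambda>z::'a. exp (- (a * B\<^sup>2) * (norm z)\<^sup>2))"
      using assms B by (intro integrable_exp_neg_square_norm) simp
    have "(B * norm z)\<^sup>2 \<le> (norm (J z))\<^sup>2" for z
      using B by (intro power_mono) auto
    then show "AE z in lborel. norm (exp (- a * (norm (J z))\<^sup>2))
        \<le> norm (exp (- (a * B\<^sup>2) * (norm z)\<^sup>2))"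
      using assms by (simp add: power_mult_distrib)
  qed simp
qed

lemma power_div_fact_le_exp:
  assumes "x \<ge> 0"
  shows "x ^ n / fact n \<le> exp (x::real)"
proof -
  have "x ^ n / fact n \<le> (\<Sum>k<Suc n. x ^ k / fact k)"
    using assms by (intro member_le_sum) auto
  also have "\<dots> \<le> (\<Sum>k. x ^ k / fact k)"
    using assms summable_exp[of x] by (intro sum_le_suminf) (auto simp: field_simps)
  also have "\<dots> = exp x"
    by (simp add: exp_def field_simps)
  finally show ?thesis .
qed

text \<open>Real exponential moments of both signs control the exponential series at every complex
  parameter, so integrating the series term by term is a case of dominated convergence. The
  resulting power series in s converges everywhere, which makes the integral an entire function of
  s.\<close>

lemma exponential_integral_sums:
  fixes G l :: "'a \<Rightarrow> real" and s :: complex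
  assumes [measurable]: "G \<in> borel_measurable M" "l \<in> borel_measurable M"
    and nonneg: "\<And>z. G z \<ge> 0"
    and int: "\<And>t. integrable M (\<lambda>z. G z * exp (t * l z))"
  shows "(\<lambda>n. (LINT z|M. G z * l z ^ n / fact n) * s ^ n) sums
      (LINT z|M. G z * exp (s * l z))"
proof -
  \<comment> \<open>Every partial sum of the series for exp (s l) is bounded by exp (|s| |l|). One
    of the two summands of \<open>?w\<close> equals that bound times G, according to the sign of l,
    and it does not depend on N.\<close>
  let ?w = "\<lambda>z. G z * exp (norm s * l z) + G z * exp (- norm s * l z)"
  let ?S = "\<lambda>N z. \<Sum>n<N. complex_of_real (G z * l z ^ n / fact n) * s ^ n"
  have w: "integrable M ?w"
    using int[of "norm s"] int[of "- norm s"] by (intro Bochner_Integration.integrable_add) auto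
  have wge: "G z * exp (norm s * \<bar>l z\<bar>) \<le> ?w z" for z
    using nonneg[of z] by (cases "l z \<ge> 0") auto
  have eq: "?S N z = complex_of_real (G z) * (\<Sum>n<N. (s * l z) ^ n / fact n)" for N z
    by (simp add: sum_distrib_left power_mult_distrib field_simps)
  have lim: "(\<lambda>N. ?S N z) \<longlonglongrightarrow> G z * exp (s * l z)" for z
  proof -
    have "(\<lambda>n. (s * l z) ^ n / fact n) sums exp (s * l z)"
      using exp_converges[of "s * l z"] by (simp add: scaleR_conv_of_real field_simps)
    then show ?thesis
      unfolding eq sums_def by (intro tendsto_intros)
  qed
  have bd: "norm (?S N z) \<le> ?w z" for N z
  proof -
    have "norm (\<Sum>n<N. (s * l z) ^ n / fact n) \<le> (\<Sum>n<N. (norm s * \<bar>l z\<bar>) ^ n / fact n)"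
      by (rule sum_norm_le) (simp add: norm_divide norm_power norm_mult power_mult_distrib)
    also have "\<dots> \<le> (\<Sum>n. (norm s * \<bar>l z\<bar>) ^ n / fact n)"
      using summable_exp[of "norm s * \<bar>l z\<bar>"]
      by (intro sum_le_suminf) (auto simp: field_simps)
    also have "\<dots> = exp (norm s * \<bar>l z\<bar>)"
      by (simp add: exp_def field_simps)
    finally have "norm (?S N z) \<le> G z * exp (norm s * \<bar>l z\<bar>)"
      unfolding eq using nonneg[of z] by (simp add: norm_mult mult_left_mono)
    with wge[of z] show ?thesis by linarith
  qed
  have term_int: "integrable M (\<lambda>z. G z * l z ^ n / fact n)" for n
  proof (rule Bochner_Integration.integrable_bound)
    show "integrable M (\<lambda>z. G z * exp (1 * l z) + G z * exp (- 1 * l z))"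
      by (intro Bochner_Integration.integrable_add int)
    have "G z * (\<bar>l z\<bar> ^ n / fact n) \<le> G z * exp \<bar>l z\<bar>" for z
      using nonneg by (intro mult_left_mono power_div_fact_le_exp) auto
    moreover have "G z * exp \<bar>l z\<bar> \<le> G z * exp (1 * l z) + G z * exp (- 1 * l z)" for z
      using nonneg[of z] by (cases "l z \<ge> 0") auto
    moreover have "0 \<le> G z * exp (1 * l z) + G z * exp (- 1 * l z)" for z
      using nonneg[of z] by simp
    ultimately have "G z * (\<bar>l z\<bar> ^ n / fact n) \<le> \<bar>G z * exp (1 * l z) + G z * exp (- 1 * l z)\<bar>" for z
      by (meson abs_ge_self order_trans)
    then show "AE z in M. norm (G z * l z ^ n / fact n)
        \<le> norm (G z * exp (1 * l z) + G z * exp (- 1 * l z))"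
      using nonneg by (simp add: abs_mult power_abs)
  qed simp
  have "(\<lambda>N. LINT z|M. ?S N z) \<longlonglongrightarrow> (LINT z|M. G z * exp (s * l z))"
    using w lim bd by (intro integral_dominated_convergence[where w = ?w]) auto
  moreover have "(LINT z|M. ?S N z) = (\<Sum>n<N. (LINT z|M. G z * l z ^ n / fact n) * s ^ n)" for N
    using term_int by (subst Bochner_Integration.integral_sum) (auto simp del: of_real_mult of_real_divide
       intro!: integrable_mult_left)
  ultimately show ?thesis
    by (simp add: sums_def)
qed

text \<open>The completed square gives the integral against a real exponential; both sides are entire
  in its parameter, which is then specialised to the imaginary unit.\<close>

lemma gaussian_fourier_integral:
  fixes J :: "'a::euclidean_space \<Rightarrow> 'b::euclidean_space"
  assumes a: "a > 0" and J: "linear J" "inj J"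
  shows "(LINT z|lborel. complex_of_real (exp (- a * (norm (J z))\<^sup>2)) * exp (\<i> * (2 * a * (J w \<bullet> J z))))
    = exp (- a * (norm (J w))\<^sup>2) * (LINT z|lborel. exp (- a * (norm (J z))\<^sup>2))"
proof -
  define G where "G = (\<lambda>z. exp (- a * (norm (J z))\<^sup>2))"
  define l where "l = (\<lambda>z. 2 * a * (J w \<bullet> J z))"
  define I where "I = (LINT z|lborel. G z)"
  have [measurable]: "J \<in> borel_measurable borel"
    using assms linear_continuous_on linear_linear borel_measurable_continuous_onI by blast
  have meas [measurable]: "G \<in> borel_measurable borel" "l \<in> borel_measurable borel"
    by (simp_all add: G_def l_def)
  have intG: "integrable lborel G"
    unfolding G_def by (rule integrable_exp_neg_square_norm_linear[OF assms])
  \<comment> \<open>Completing the square: the factor 2a in \<open>l\<close> is chosen so that the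
    new Gaussian is centred exactly at t w, and translation invariance then removes the
    shift.\<close>
  have square: "G z * exp (t * l z) = exp (a * t\<^sup>2 * (norm (J w))\<^sup>2) * G ((- t *\<^sub>R w) + z)" for t z
  proof -
    have eq: "J ((- t *\<^sub>R w) + z) = J z - t *\<^sub>R J w"
      using J by (simp add: linear_diff linear_scale)
    show ?thesis
      unfolding G_def l_def exp_add[symmetric] exp_inj_iff eq power2_norm_eq_inner
      by (simp add: inner_simps inner_commute algebra_simps power2_eq_square)
  qed
  have int: "integrable lborel (\<lambda>z. G z * exp (t * l z))" for t
    unfolding square using integrable_lborel_translate[OF meas(1), of "- t *\<^sub>R w"] intG by simp
  have real_case: "(LINT z|lborel. G z * exp (t * l z)) = exp (a * t\<^sup>2 * (norm (J w))\<^sup>2) * I" for t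
    unfolding square I_def using integral_lborel_translate[OF meas(1), of "- t *\<^sub>R w"] by simp
  define F where "F = (\<lambda>s::complex. LINT z|lborel. complex_of_real (G z) * exp (s * l z))"
  define E where "E = (\<lambda>s::complex. exp (a * s\<^sup>2 * (norm (J w))\<^sup>2) * complex_of_real I)"
  have "(\<lambda>n. (LINT z|lborel. G z * l z ^ n / fact n) * s ^ n) sums F s" for s :: complex
    unfolding F_def by (rule exponential_integral_sums) (use int in \<open>auto simp: G_def\<close>)
  \<comment> \<open>The radius 2 gives a disc containing both the real segment [-1, 1], where the
    two functions agree, and the point i, where the equality is wanted.\<close>
  then have "F holomorphic_on ball 0 2"
    by (intro power_series_holomorphic[where a = "\<lambda>n. complex_of_real (LINT z|lborel. G z * l z ^ n / fact n)"])
       auto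
  moreover have "E holomorphic_on ball 0 2"
    unfolding E_def by (intro holomorphic_intros)
  ultimately have hol: "(\<lambda>s. F s - E s) holomorphic_on ball 0 2"
    by (intro holomorphic_intros)
  have "F (complex_of_real t) = E (complex_of_real t)" for t
  proof -
    have "F (complex_of_real t) = complex_of_real (LINT z|lborel. G z * exp (t * l z))"
      unfolding F_def by (subst integral_complex_of_real[symmetric]) (simp add: exp_of_real[symmetric])
    then show ?thesis
      unfolding real_case E_def by (simp add: exp_of_real[symmetric])
  qed
  then have zero: "F s - E s = 0" if "s \<in> complex_of_real ` {-1..1}" for s
    using that by auto
  have "0 islimpt complex_of_real ` {-1..1}"
    unfolding islimpt_approachable
  proof (intro allI impI)
    fix e :: real assume "e > 0"
    then show "\<exists>x'\<in>complex_of_real ` {-1..1}. x' \<noteq> 0 \<and> dist x' 0 < e"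
      by (intro bexI[of _ "complex_of_real (min 1 (e / 2))"]) auto
  qed
  then have "F \<i> - E \<i> = 0"
    by (rule analytic_continuation[OF hol open_ball connected_ball, rotated 2])
       (use zero in auto)
  then show ?thesis
    unfolding F_def E_def G_def l_def I_def
    by (simp add: exp_of_real[symmetric] del: integral_complex_of_real)
qed

subsection \<open>The Schroedinger representation on Gaussians\<close>

lemma borel_measurable_cnj [measurable (raw)]:
  "f \<in> borel_measurable M \<Longrightarrow> (\<lambda>x. cnj (f x)) \<in> borel_measurable M"
  by (rule measurable_compose[where g = cnj and N = borel])
     (auto intro!: borel_measurable_continuous_onI continuous_intros)

lemma (in pair_sigma_finite) integrable_pair_mult:
  fixes u :: "'a \<Rightarrow> 'c::{real_normed_field, banach, second_countable_topology}"
  assumes [measurable]: "integrable M1 u" "integrable M2 v"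
  shows "integrable (M1 \<Otimes>\<^sub>M M2) (\<lambda>(x, y). u x * v y)"
  by (rule Fubini_integrable) (auto simp: norm_mult intro!: assms integrable_norm)

lemma L2_space_mult_integrable:
  assumes "f \<in> L2_space" "g \<in> L2_space"
  shows "integrable lborel (\<lambda>t. f t * g t)"
proof -
  have [measurable]: "f \<in> borel_measurable borel" "g \<in> borel_measurable borel"
    using assms by (auto simp: L2_space_def)
  show ?thesis
  proof (rule Bochner_Integration.integrable_bound)
    show "integrable lborel (\<lambda>t. (norm (f t))\<^sup>2 + (norm (g t))\<^sup>2)"
      using assms by (auto simp: L2_space_def)
    have "norm (f t) * norm (g t) \<le> (norm (f t))\<^sup>2 + (norm (g t))\<^sup>2" for t
    proof -
      have "2 * (norm (f t) * norm (g t)) \<le> (norm (f t))\<^sup>2 + (norm (g t))\<^sup>2"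
        using sum_squares_bound[of "norm (f t)" "norm (g t)"] by (simp add: mult.assoc)
      moreover have "0 \<le> norm (f t) * norm (g t)"
        by simp
      ultimately show ?thesis
        by linarith
    qed
    then show "AE t in lborel. norm (f t * g t) \<le> norm ((norm (f t))\<^sup>2 + (norm (g t))\<^sup>2)"
      by (simp add: norm_mult)
  qed simp
qed

lemma L2_space_cnj: "f \<in> L2_space \<Longrightarrow> (\<lambda>t. cnj (f t)) \<in> L2_space"
  by (auto simp: L2_space_def)

lemma L2_space_translate:
  assumes "f \<in> L2_space"
  shows "(\<lambda>t. f (t - p)) \<in> L2_space"
proof -
  have [measurable]: "f \<in> borel_measurable borel"
    using assms by (auto simp: L2_space_def)
  show ?thesis
    using assms integrable_lborel_translate[of "\<lambda>t. (norm (f t))\<^sup>2" "- p"]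
    by (simp add: L2_space_def)
qed

lemma L2_space_schroedinger_rep:
  assumes "f \<in> L2_space"
  shows "schroedinger_rep p q \<tau> f \<in> L2_space"
proof -
  have "(\<lambda>t. f (t - p)) \<in> L2_space"
    using assms by (rule L2_space_translate)
  moreover have [measurable]: "f \<in> borel_measurable borel"
    using assms by (auto simp: L2_space_def)
  moreover have "norm (schroedinger_rep p q \<tau> f t) = norm (f (t - p))" for t
    by (simp add: schroedinger_rep_def norm_mult)
  moreover have "schroedinger_rep p q \<tau> f \<in> borel_measurable borel"
    unfolding schroedinger_rep_def by measurable
  ultimately show ?thesis
    by (simp add: L2_space_def)
qed

lemma borel_measurable_gaussian [measurable]:
  "(gaussian :: 'a::euclidean_space \<Rightarrow> complex) \<in> borel_measurable borel"
  unfolding gaussian_def by measurable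

lemma gaussian_translate_in_L2_space:
  "(\<lambda>t. gaussian (t - x)) \<in> L2_space"
proof (rule L2_space_translate)
  have "(norm (gaussian (t::'a)))\<^sup>2 = exp (- (2 * pi) * (norm t)\<^sup>2)" for t
    by (simp add: gaussian_def exp_add[symmetric] power2_eq_square)
  then show "(gaussian :: 'a \<Rightarrow> complex) \<in> L2_space"
    using integrable_exp_neg_square_norm[of "2 * pi"] by (simp add: L2_space_def)
qed

text \<open>After exchanging the integrals, the reflection p \<mapsto> t - p turns the inner one
  into the total integral of F, independent of t. What remains is that integral times its
  conjugate.\<close>

lemma integral_autocorrelation:
  fixes F :: "'a::euclidean_space \<Rightarrow> complex"
  assumes F: "integrable lborel F"
  shows "(LINT p|lborel. LINT t|lborel. F (t - p) * cnj (F t)) = (norm (LINT t|lborel. F t))\<^sup>2"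
proof -
  have [measurable]: "F \<in> borel_measurable borel"
    using F by simp
  let ?H = "\<lambda>t p. F (t - p) * cnj (F t)"
  have intp: "integrable lborel (\<lambda>p. F (t - p))" for t
    using F by (simp add: integrable_lborel_reflect)
  have "integrable (lborel \<Otimes>\<^sub>M lborel) (case_prod ?H)"
  proof (rule lborel_pair.Fubini_integrable)
    have "(LINT p|lborel. norm (?H t p)) = (LINT p|lborel. norm (F p)) * norm (F t)" for t
      using integral_lborel_reflect[of "\<lambda>p. norm (F p)" t] by (simp add: norm_mult)
    then show "integrable lborel (\<lambda>t. LINT p|lborel. norm (case_prod ?H (t, p)))"
      using F by simp
    show "AE t in lborel. integrable lborel (\<lambda>p. case_prod ?H (t, p))"
      using intp by simp
  qed measurable
  then have "(LINT p|lborel. LINT t|lborel. ?H t p) = (LINT t|lborel. LINT p|lborel. ?H t p)"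
    by (rule lborel_pair.Fubini_integral)
  also have "\<dots> = (LINT t|lborel. (LINT p|lborel. F p) * cnj (F t))"
    using integral_lborel_reflect[of F] by simp
  also have "\<dots> = (LINT p|lborel. F p) * cnj (LINT p|lborel. F p)"
    using F by simp
  finally show ?thesis
    by (simp only: complex_norm_square)
qed

text \<open>This is the diagonal matrix coefficient <rho(p, q; 0) f, f>, also known as the
  Fourier-Wigner transform of f. It does not change when f is multiplied by a constant of modulus
  1.\<close>

definition ambiguity :: "(real^'n \<Rightarrow> complex) \<Rightarrow> real^'n \<Rightarrow> real^'n \<Rightarrow> complex" where
  "ambiguity f p q = (LINT t|lborel. schroedinger_rep p q 0 f t * cnj (f t))"

text \<open>Von Neumann's identity: a Gaussian average of the Schroedinger representation is, up to a
  constant, the projection onto the Gaussian.\<close>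

lemma gaussian_average_ambiguity:
  fixes f :: "real^'n \<Rightarrow> complex"
  assumes f: "f \<in> L2_space"
  shows "(LINT p|lborel. LINT q|lborel.
      exp (- (pi / 2) * ((norm p)\<^sup>2 + (norm q)\<^sup>2)) * exp (- 2 * pi * \<i> * (q \<bullet> x)) * ambiguity f p q)
    = complex_of_real (LINT q|lborel. exp (- (pi / 2) * (norm (q :: real^'n))\<^sup>2))
        * complex_of_real ((norm (LINT t|lborel. f t * gaussian (t - x)))\<^sup>2)"
    (is "(LINT p|lborel. LINT q|lborel. ?L p q) = complex_of_real ?c * _")
proof -
  have [measurable]: "f \<in> borel_measurable borel"
    using f by (auto simp: L2_space_def)
  define F where "F = (\<lambda>t. f t * gaussian (t - x))"
  have F: "integrable lborel F"
    unfolding F_def by (intro L2_space_mult_integrable f gaussian_translate_in_L2_space)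
  define e where "e = (\<lambda>q::real^'n. exp (- (pi / 2) * (norm q)\<^sup>2))"
  have [measurable]: "e \<in> borel_measurable borel"
    unfolding e_def by measurable
  have e: "integrable lborel e"
    unfolding e_def by (rule integrable_exp_neg_square_norm) simp
  have "(LINT q|lborel. ?L p q) = ?c * (LINT t|lborel. F (t - p) * cnj (F t))" for p
  proof -
    define u where "u = (\<lambda>t. f (t - p) * cnj (f t))"
    have u: "integrable lborel u"
      unfolding u_def by (intro L2_space_mult_integrable L2_space_cnj L2_space_translate f)
    have [measurable]: "u \<in> borel_measurable borel"
      using u by simp
    \<comment> \<open>The three phases exp (-2 pi i q.x), exp (-i pi p.q) and exp (2 pi i q.t) merge
      into exp (i pi q.(2 (t - x) - p)). It is written with the factor 2 * (pi / 2) to match the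
      Gaussian Fourier integral for a = pi / 2, J = id, w = 2 (t - x) - p.\<close>
    define H where "H = (\<lambda>q t. complex_of_real (e p) *
      (e q * exp (\<i> * (2 * (pi / 2) * ((2 *\<^sub>R (t - x) - p) \<bullet> q))) * u t))"
    have "integrable (lborel \<Otimes>\<^sub>M lborel) (case_prod H)"
    proof (rule Bochner_Integration.integrable_bound)
      show "integrable (lborel \<Otimes>\<^sub>M lborel) (\<lambda>(q, t). complex_of_real (e q) * u t)"
        using e u by (intro lborel_pair.integrable_pair_mult) auto
      have "e p \<le> 1"
        by (simp add: e_def)
      then have "norm (H q t) \<le> norm (complex_of_real (e q) * u t)" for q t
        using mult_right_mono[of "e p" 1 "e q * norm (u t)"]
        by (simp add: H_def norm_mult e_def norm_exp_i_times del: exp_le_one_iff)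
      then show "AE z in lborel \<Otimes>\<^sub>M lborel.
          norm (case_prod H z) \<le> norm (case z of (q, t) \<Rightarrow> complex_of_real (e q) * u t)"
        by auto
      show "case_prod H \<in> borel_measurable (lborel \<Otimes>\<^sub>M lborel)"
        unfolding H_def by measurable
    qed
    note swap = lborel_pair.Fubini_integral[OF this]
    have L_eq: "?L p q = (LINT t|lborel. H q t)" for q
    proof -
      have "exp (- (pi / 2) * ((norm p)\<^sup>2 + (norm q)\<^sup>2)) * exp (- 2 * pi * \<i> * (q \<bullet> x))
          * (schroedinger_rep p q 0 f t * cnj (f t)) = H q t" for t
      proof -
        have "exp (\<i> * (2 * (pi / 2) * ((2 *\<^sub>R (t - x) - p) \<bullet> q))) =
          exp (- 2 * pi * \<i> * (q \<bullet> x)) * exp (- \<i> * pi * (p \<bullet> q)) * exp (2 * pi * \<i> * (q \<bullet> t))"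
          unfolding exp_add[symmetric]
          by (rule arg_cong[of _ _ exp]) (simp add: inner_simps inner_commute algebra_simps)
        moreover have "exp (- (pi / 2) * ((norm p)\<^sup>2 + (norm q)\<^sup>2)) = e p * e q"
          unfolding e_def exp_add[symmetric] by (simp add: algebra_simps)
        ultimately show ?thesis
          by (simp add: H_def u_def schroedinger_rep_def algebra_simps)
      qed
      then show ?thesis
        unfolding ambiguity_def integral_mult_right_zero[symmetric] by simp
    qed
    have inner: "(LINT q|lborel. H q t) = ?c * (F (t - p) * cnj (F t))" for t
    proof -
      \<comment> \<open>The parallelogram law for the vectors t - x and t - x - p, whose difference
        is p and whose sum is 2 (t - x) - p. This is why the weight has the constant pi / 2: the
        weight in p and the Fourier transform in q combine into two copies of the Gaussian at x, one
        shifted by p, hence into an autocorrelation.\<close>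
      have merge: "complex_of_real (e p) * complex_of_real (exp (- (pi / 2) * (norm (2 *\<^sub>R (t - x) - p))\<^sup>2))
          = gaussian (t - p - x) * gaussian (t - x)"
      proof -
        have "- (pi / 2) * (norm p)\<^sup>2 + - (pi / 2) * (norm (2 *\<^sub>R (t - x) - p))\<^sup>2
            = - pi * (norm (t - p - x))\<^sup>2 + - pi * (norm (t - x))\<^sup>2"
          unfolding power2_norm_eq_inner by (simp add: inner_simps inner_commute algebra_simps)
        then show ?thesis
          unfolding e_def gaussian_def of_real_mult[symmetric] exp_add[symmetric] by simp
      qed
      have "(LINT q|lborel. H q t) = e p * u t *
          (LINT q|lborel. complex_of_real (e q) * exp (\<i> * (2 * (pi / 2) * ((2 *\<^sub>R (t - x) - p) \<bullet> q))))"
        unfolding integral_mult_right_zero[symmetric] by (simp add: H_def algebra_simps)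
      also have "\<dots> = e p * u t * (exp (- (pi / 2) * (norm (2 *\<^sub>R (t - x) - p))\<^sup>2) * ?c)"
        using gaussian_fourier_integral[of "pi / 2" id "2 *\<^sub>R (t - x) - p"]
        by (simp add: e_def linear_id)
      also have "\<dots> = ?c * (complex_of_real (e p) *
          complex_of_real (exp (- (pi / 2) * (norm (2 *\<^sub>R (t - x) - p))\<^sup>2))) * u t"
        by (simp only: of_real_mult mult_ac)
      also have "\<dots> = ?c * (F (t - p) * cnj (F t))"
        unfolding merge by (simp add: F_def u_def gaussian_def mult_ac)
      finally show ?thesis .
    qed
    have "(LINT q|lborel. ?L p q) = (LINT q|lborel. LINT t|lborel. H q t)"
      by (simp only: L_eq)
    also have "\<dots> = (LINT t|lborel. LINT q|lborel. H q t)"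
      using swap by simp
    finally show ?thesis
      by (simp add: inner)
  qed
  then show ?thesis
    by (simp add: integral_autocorrelation[OF F] flip: F_def)
qed

text \<open>The substitution t = y + p/2 + s puts the origin midway between the two centres y and y
  + p. The product of the Gaussians becomes exp (-(pi/2) |p|^2) exp (-2 pi |s|^2), the phase exp (-i
  pi p.q) cancels, and the s-integral is a Fourier transform at q/2. The centre y survives only in a
  phase.\<close>

lemma ambiguity_gaussian:
  fixes y p q :: "real^'n"
  shows "ambiguity (\<lambda>t. gaussian (t - y)) p q
    = complex_of_real (LINT s|lborel. exp (- (2 * pi) * (norm (s :: real^'n))\<^sup>2))
      * complex_of_real (exp (- (pi / 2) * ((norm p)\<^sup>2 + (norm q)\<^sup>2))) * exp (2 * pi * \<i> * (q \<bullet> y))"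
    (is "_ = complex_of_real ?c * _ * _")
proof -
  let ?f = "\<lambda>t. schroedinger_rep p q 0 (\<lambda>t. gaussian (t - y)) t * cnj (gaussian (t - y))"
  have "?f (y + (1/2) *\<^sub>R p + s) = complex_of_real (exp (- (pi / 2) * (norm p)\<^sup>2))
      * exp (2 * pi * \<i> * (q \<bullet> y))
      * (complex_of_real (exp (- (2 * pi) * (norm s)\<^sup>2))
      * exp (\<i> * (2 * (2 * pi) * (((1/2) *\<^sub>R q) \<bullet> s))))" for s
  proof -
    let ?t = "y + (1/2) *\<^sub>R p + s"
    have "exp (- \<i> * pi * (p \<bullet> q)) * exp (2 * pi * \<i> * (q \<bullet> ?t))
      = exp (2 * pi * \<i> * (q \<bullet> y)) * exp (\<i> * (2 * (2 * pi) * (((1/2) *\<^sub>R q) \<bullet> s)))"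
      unfolding exp_add[symmetric]
      by (rule arg_cong[of _ _ exp]) (simp add: inner_simps inner_commute algebra_simps)
    moreover have "gaussian (?t - p - y) * gaussian (?t - y)
      = complex_of_real (exp (- (pi / 2) * (norm p)\<^sup>2) * exp (- (2 * pi) * (norm s)\<^sup>2))"
      unfolding gaussian_def of_real_mult[symmetric] exp_add[symmetric] power2_norm_eq_inner
      by (rule arg_cong[of _ _ "\<lambda>r. complex_of_real (exp r)"])
         (simp add: inner_simps inner_commute algebra_simps)
    moreover have "cnj (gaussian (?t - y)) = gaussian (?t - y)"
      by (simp add: gaussian_def)
    ultimately show ?thesis
      by (simp add: schroedinger_rep_def mult_ac)
  qed
  note shifted = this
  have [measurable]: "?f \<in> borel_measurable borel"
    unfolding schroedinger_rep_def by measurable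
  have merge: "complex_of_real (exp (- (pi / 2) * ((norm p)\<^sup>2 + (norm q)\<^sup>2)))
      = complex_of_real (exp (- (pi / 2) * (norm p)\<^sup>2))
        * complex_of_real (exp (- (2 * pi) * (norm ((1/2) *\<^sub>R q))\<^sup>2))"
    unfolding of_real_mult[symmetric] exp_add[symmetric]
    by (simp add: algebra_simps power_mult_distrib power2_eq_square)
  have "ambiguity (\<lambda>t. gaussian (t - y)) p q = (LINT s|lborel. ?f (y + (1/2) *\<^sub>R p + s))"
    unfolding ambiguity_def by (rule integral_lborel_translate[symmetric]) simp
  also have "\<dots> = exp (- (pi / 2) * (norm p)\<^sup>2) * exp (2 * pi * \<i> * (q \<bullet> y))
      * (exp (- (2 * pi) * (norm ((1/2) *\<^sub>R q))\<^sup>2) * ?c)"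
    unfolding shifted integral_mult_right_zero
    using gaussian_fourier_integral[of "2 * pi" id "(1/2) *\<^sub>R q"] by (simp add: linear_id)
  also have "\<dots> = complex_of_real ?c * complex_of_real (exp (- (pi / 2) * ((norm p)\<^sup>2 + (norm q)\<^sup>2)))
      * exp (2 * pi * \<i> * (q \<bullet> y))"
    unfolding merge by (simp only: of_real_mult mult_ac)
  finally show ?thesis .
qed

subsection \<open>Gaussians as Schwartz functions\<close>

lemma japanese_bracket_ge_1: "japanese_bracket x \<ge> 1"
  by (simp add: japanese_bracket_def)

text \<open>With r = 1 + |v|^2, a single term of the series of exp (a r) bounds r^N, and exp (a r)
  exp (-a |v|^2) = exp a. The bound, uniform in v, serves both the Schwartz seminorms of Gaussians
  and the off-diagonal decay of the kernel.\<close>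

lemma japanese_bracket_power_mult_exp_le:
  fixes v :: "'a::real_normed_vector"
  assumes "a > 0"
  shows "japanese_bracket v ^ (2 * N) * exp (- a * (norm v)\<^sup>2) \<le> fact N * exp a / a ^ N"
proof -
  define r where "r = 1 + (norm v)\<^sup>2"
  have "japanese_bracket v ^ (2 * N) = r ^ N"
    by (simp add: japanese_bracket_def power_mult r_def)
  moreover have "(a * r) ^ N / fact N \<le> exp (a * r)"
    using assms by (intro power_div_fact_le_exp) (auto simp: r_def)
  then have "r ^ N \<le> fact N * exp (a * r) / a ^ N"
    using assms by (simp add: power_mult_distrib field_simps)
  then have "r ^ N * exp (- a * (norm v)\<^sup>2)
      \<le> fact N * exp (a * r) / a ^ N * exp (- a * (norm v)\<^sup>2)"
    by (rule mult_right_mono) simp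
  moreover have "exp (a * r) * exp (- a * (norm v)\<^sup>2) = exp a"
    unfolding exp_add[symmetric] by (simp add: r_def algebra_simps)
  ultimately show ?thesis
    by (metis (no_types, lifting) mult.assoc times_divide_eq_left)
qed

text \<open>A crude form of Peetre's inequality, which moves a polynomial weight from the origin to
  the centre c. The squares on the right cost nothing, since a Gaussian absorbs every power of the
  bracket.\<close>

lemma japanese_bracket_peetre:
  "japanese_bracket x \<le> 2 * japanese_bracket c ^ 2 * japanese_bracket (x - c) ^ 2"
proof -
  have "norm x \<le> norm (x - c) + norm c"
    by (metis diff_add_cancel norm_triangle_ineq)
  then have "(norm x)\<^sup>2 \<le> (norm (x - c) + norm c)\<^sup>2"
    by (intro power_mono) auto
  also have "\<dots> \<le> 2 * (norm (x - c))\<^sup>2 + 2 * (norm c)\<^sup>2"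
    using sum_squares_bound[of "norm (x - c)" "norm c"] by (simp add: power2_sum)
  finally have *: "(norm x)\<^sup>2 \<le> 2 * (norm (x - c))\<^sup>2 + 2 * (norm c)\<^sup>2" .
  have "1 + (norm x)\<^sup>2 \<le> 2 * (1 + (norm c)\<^sup>2) * (1 + (norm (x - c))\<^sup>2)"
  proof -
    have "2 * (1 + (norm c)\<^sup>2) * (1 + (norm (x - c))\<^sup>2)
        = 2 + 2 * (norm c)\<^sup>2 + 2 * (norm (x - c))\<^sup>2 + 2 * ((norm c)\<^sup>2 * (norm (x - c))\<^sup>2)"
      by (simp add: algebra_simps)
    moreover have "0 \<le> (norm c)\<^sup>2 * (norm (x - c))\<^sup>2"
      by simp
    ultimately show ?thesis
      using * by linarith
  qed
  moreover have "japanese_bracket x \<le> japanese_bracket x ^ 2"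
    using self_le_power[OF japanese_bracket_ge_1, of 2 x] by simp
  ultimately show ?thesis
    by (simp add: japanese_bracket_def)
qed

text \<open>Differentiability and the value of the derivative in direction b are kept in one
  existential statement, so that the induction over sums and products carries both, and the partial
  derivative is again a polynomial that can be differentiated further.\<close>

lemma real_polynomial_function_has_partial_derivative:
  assumes "real_polynomial_function p"
  shows "\<exists>q. real_polynomial_function q \<and> (\<forall>x. \<exists>D. (p has_derivative D) (at x) \<and> D b = q x)"
  using assms
proof induction
  case (linear f)
  then show ?case
    by (intro exI[of _ "\<lambda>x. f b"])
       (auto intro: real_polynomial_function.intros(2) bounded_linear_imp_has_derivative)
next
  case (const c)
  show ?case
    by (intro exI[of _ "\<lambda>x. 0"])
       (auto intro!: real_polynomial_function.intros(2) exI[of _ "\<lambda>h. 0"])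
next
  case (add f g)
  then obtain qf qg where q: "real_polynomial_function qf" "real_polynomial_function qg"
    and f: "\<And>x. \<exists>D. (f has_derivative D) (at x) \<and> D b = qf x"
    and g: "\<And>x. \<exists>D. (g has_derivative D) (at x) \<and> D b = qg x"
    by blast
  have "\<exists>D. ((\<lambda>x. f x + g x) has_derivative D) (at x) \<and> D b = qf x + qg x" for x
    using f[of x] g[of x] by (metis has_derivative_add)
  then show ?case
    using q by (intro exI[of _ "\<lambda>x. qf x + qg x"]) (auto intro: real_polynomial_function.intros(3))
next
  case (mult f g)
  then obtain qf qg where q: "real_polynomial_function qf" "real_polynomial_function qg"
    and f: "\<And>x. \<exists>D. (f has_derivative D) (at x) \<and> D b = qf x"
    and g: "\<And>x. \<exists>D. (g has_derivative D) (at x) \<and> D b = qg x"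
    by blast
  have "\<exists>D. ((\<lambda>x. f x * g x) has_derivative D) (at x) \<and> D b = f x * qg x + qf x * g x" for x
  proof -
    obtain D E where "(f has_derivative D) (at x)" "D b = qf x"
      "(g has_derivative E) (at x)" "E b = qg x"
      using f[of x] g[of x] by blast
    then show ?thesis
      using has_derivative_mult[of f D x UNIV g E]
      by (intro exI[of _ "\<lambda>h. f x * E h + D h * g x"]) auto
  qed
  then show ?case
    using q mult.hyps
    by (intro exI[of _ "\<lambda>x. f x * qg x + qf x * g x"])
       (auto intro!: real_polynomial_function.intros(3) real_polynomial_function.intros(4))
qed

lemma real_polynomial_function_growth:
  assumes "real_polynomial_function p"
  shows "\<exists>K m. \<forall>x. \<bar>p x\<bar> \<le> K * japanese_bracket x ^ m"
  using assms
proof induction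
  case (linear f)
  then obtain K where K: "K > 0" "\<And>x. \<bar>f x\<bar> \<le> norm x * K"
    using bounded_linear.pos_bounded by (metis real_norm_def)
  have "norm x \<le> japanese_bracket x" for x :: 'a
    unfolding japanese_bracket_def by (intro real_le_rsqrt) simp
  then have "\<bar>f x\<bar> \<le> K * japanese_bracket x ^ 1" for x
    using K by (metis mult.commute mult_right_mono order_trans less_imp_le power_one_right)
  then show ?case
    by blast
next
  case (const c)
  have "\<bar>c\<bar> \<le> \<bar>c\<bar> * japanese_bracket x ^ 0" for x :: 'a
    by simp
  then show ?case
    by blast
next
  case (add f g)
  then obtain K m L n where *: "\<And>x. \<bar>f x\<bar> \<le> K * japanese_bracket x ^ m"
    "\<And>x. \<bar>g x\<bar> \<le> L * japanese_bracket x ^ n"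
    by blast
  have "\<bar>f x + g x\<bar> \<le> (\<bar>K\<bar> + \<bar>L\<bar>) * japanese_bracket x ^ (m + n)" for x
  proof -
    have "\<bar>f x\<bar> \<le> \<bar>K\<bar> * japanese_bracket x ^ (m + n)"
      using *(1)[of x] japanese_bracket_ge_1[of x]
      by (intro order_trans[OF *(1)] mult_mono power_increasing) auto
    moreover have "\<bar>g x\<bar> \<le> \<bar>L\<bar> * japanese_bracket x ^ (m + n)"
      using *(2)[of x] japanese_bracket_ge_1[of x]
      by (intro order_trans[OF *(2)] mult_mono power_increasing) auto
    ultimately show ?thesis
      by (simp add: algebra_simps)
  qed
  then show ?case
    by blast
next
  case (mult f g)
  then obtain K m L n where *: "\<And>x. \<bar>f x\<bar> \<le> K * japanese_bracket x ^ m"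
    "\<And>x. \<bar>g x\<bar> \<le> L * japanese_bracket x ^ n"
    by blast
  have "\<bar>f x * g x\<bar> \<le> (K * L) * japanese_bracket x ^ (m + n)" for x
    using mult_mono'[OF *(1)[of x] *(2)[of x]] by (simp add: abs_mult power_add algebra_simps)
  then show ?case
    by blast
qed

text \<open>The polynomials are rescaled Hermite polynomials centred at c. Only their recursion
  enters: differentiating in direction b replaces p by its b-derivative minus 2 pi ((x - c).b)
  p.\<close>

lemma iterated_partial_gaussian:
  "\<exists>p. real_polynomial_function p \<and>
    iterated_partial bs (\<lambda>x. gaussian (x - c)) =
      (\<lambda>x. complex_of_real (p x * exp (- pi * (norm (x - c))\<^sup>2)))"
proof (induction bs)
  case Nil
  then show ?case
    by (intro exI[of _ "\<lambda>x. 1"]) (auto simp: gaussian_def intro: real_polynomial_function.intros(2))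
next
  case (Cons b bs)
  let ?e = "\<lambda>x. exp (- pi * (norm (x - c))\<^sup>2)"
  obtain p where p: "real_polynomial_function p"
    "iterated_partial bs (\<lambda>x. gaussian (x - c)) = (\<lambda>x. complex_of_real (p x * ?e x))"
    using Cons by blast
  obtain q where q: "real_polynomial_function q"
    "\<And>x. \<exists>D. (p has_derivative D) (at x) \<and> D b = q x"
    using real_polynomial_function_has_partial_derivative[OF p(1)] by blast
  have "frechet_derivative (\<lambda>x. complex_of_real (p x * ?e x)) (at x) b
      = complex_of_real ((q x - 2 * pi * ((x - c) \<bullet> b) * p x) * ?e x)" for x
  proof -
    obtain D where D [derivative_intros]: "(p has_derivative D) (at x)" and "D b = q x"
      using q(2) by blast
    have "((\<lambda>x. complex_of_real (p x * ?e x)) has_derivative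
        (\<lambda>h. complex_of_real (D h * ?e x - 2 * pi * ((x - c) \<bullet> h) * p x * ?e x))) (at x)"
      unfolding power2_norm_eq_inner
      by (rule has_derivative_eq_rhs, (rule derivative_eq_intros refl)+)
         (simp add: inner_commute algebra_simps fun_eq_iff)
    from fun_cong[OF frechet_derivative_at[OF this], of b] show ?thesis
      using \<open>D b = q x\<close> by (simp add: algebra_simps)
  qed
  moreover have "real_polynomial_function (\<lambda>x. (x - c) \<bullet> b)"
    unfolding inner_diff_left
    by (intro real_polynomial_function_diff real_polynomial_function.intros(1)[OF bounded_linear_inner_left]
          real_polynomial_function.intros(2))
  then have "real_polynomial_function (\<lambda>x. q x - 2 * pi * ((x - c) \<bullet> b) * p x)"
    using p(1) q(1)
    by (intro real_polynomial_function_diff real_polynomial_function.intros(4) real_polynomial_function.intros(2))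
  ultimately show ?case
    unfolding iterated_partial.simps p(2)
    by (intro exI[of _ "\<lambda>x. q x - 2 * pi * ((x - c) \<bullet> b) * p x"]) auto
qed

text \<open>The kernel identity speaks only of Schwartz test functions, and the smoothed kernel at
  (x, y) tests against Gaussians centred at x and y, so membership is required for every
  centre.\<close>

lemma gaussian_translate_in_schwartz_space:
  "(\<lambda>x::'a::euclidean_space. gaussian (x - c)) \<in> schwartz_space"
  unfolding schwartz_space_def smooth_def
proof (intro CollectI conjI allI impI)
  fix bs :: "'a list" and x :: 'a
  obtain p where p: "real_polynomial_function p"
    "iterated_partial bs (\<lambda>x. gaussian (x - c)) =
      (\<lambda>x. complex_of_real (p x * exp (- pi * (norm (x - c))\<^sup>2)))"
    using iterated_partial_gaussian by blast
  obtain D where D [derivative_intros]: "(p has_derivative D) (at x)"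
    using real_polynomial_function_has_partial_derivative[OF p(1)] by blast
  have "\<exists>E. ((\<lambda>x. complex_of_real (p x * exp (- pi * ((x - c) \<bullet> (x - c))))) has_derivative E) (at x)"
    by (rule exI, (rule derivative_eq_intros refl)+)
  then show "iterated_partial bs (\<lambda>x. gaussian (x - c)) differentiable at x"
    unfolding p(2) differentiable_def power2_norm_eq_inner by simp
next
  fix m and bs :: "'a list"
  obtain p where p: "real_polynomial_function p"
    "iterated_partial bs (\<lambda>x. gaussian (x - c)) =
      (\<lambda>x. complex_of_real (p x * exp (- pi * (norm (x - c))\<^sup>2)))"
    using iterated_partial_gaussian by blast
  obtain K n where K: "\<And>x. \<bar>p x\<bar> \<le> K * japanese_bracket x ^ n"
    using real_polynomial_function_growth[OF p(1)] by blast
  \<comment> \<open>At the origin the bracket equals 1, so the growth bound there reads |p 0| \<le>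
    K.\<close>
  have "K \<ge> 0"
    using K[of 0] by (auto simp: japanese_bracket_def)
  let ?N = "m + n" and ?P = "2 * japanese_bracket c ^ 2"
  show "bdd_above (range (\<lambda>x. japanese_bracket x ^ m *
      norm (iterated_partial bs (\<lambda>x. gaussian (x - c)) x)))"
  proof (rule bdd_aboveI2)
    fix x :: 'a
    let ?e = "exp (- pi * (norm (x - c))\<^sup>2)"
    have "japanese_bracket x ^ m * norm (iterated_partial bs (\<lambda>x. gaussian (x - c)) x)
        = japanese_bracket x ^ m * (\<bar>p x\<bar> * ?e)"
      unfolding p(2) by (simp add: abs_mult norm_mult)
    also have "\<dots> \<le> japanese_bracket x ^ m * ((K * japanese_bracket x ^ n) * ?e)"
      using K[of x] japanese_bracket_ge_1[of x] by (intro mult_left_mono mult_right_mono) auto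
    also have "\<dots> = K * (japanese_bracket x ^ ?N * ?e)"
      by (simp add: power_add)
    also have "\<dots> \<le> K * ((?P * japanese_bracket (x - c) ^ 2) ^ ?N * ?e)"
      using \<open>K \<ge> 0\<close> japanese_bracket_ge_1[of x] japanese_bracket_peetre[of x c]
      by (intro mult_left_mono mult_right_mono power_mono) auto
    also have "\<dots> = K * (?P ^ ?N * (japanese_bracket (x - c) ^ (2 * ?N) * ?e))"
      by (simp only: power_mult[symmetric] power_mult_distrib mult.assoc)
    also have "\<dots> \<le> K * (?P ^ ?N * (fact ?N * exp pi / pi ^ ?N))"
      using \<open>K \<ge> 0\<close> japanese_bracket_power_mult_exp_le[of pi "x - c" ?N]
      by (intro mult_left_mono) auto
    finally show "japanese_bracket x ^ m * norm (iterated_partial bs (\<lambda>x. gaussian (x - c)) x)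
      \<le> K * (?P ^ ?N * (fact ?N * exp pi / pi ^ ?N))" .
  qed
qed

subsection \<open>Continuity of Gaussian matrix coefficients\<close>

lemma L2_space_Cauchy_Schwarz:
  assumes "f \<in> L2_space" "g \<in> L2_space"
  shows "norm (LINT t|lborel. f t * g t)
    \<le> sqrt (LINT t|lborel. (norm (f t))\<^sup>2) * sqrt (LINT t|lborel. (norm (g t))\<^sup>2)"
proof -
  have [measurable]: "f \<in> borel_measurable borel" "g \<in> borel_measurable borel"
    and int: "integrable lborel (\<lambda>t. (norm (f t))\<^sup>2)" "integrable lborel (\<lambda>t. (norm (g t))\<^sup>2)"
    using assms by (auto simp: L2_space_def)
  let ?I = "LINT t|lborel. norm (f t) * norm (g t)"
  have intfg: "integrable lborel (\<lambda>t. norm (f t) * norm (g t))"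
    using integrable_norm[OF L2_space_mult_integrable[OF assms]] by (simp add: norm_mult)
  have "ennreal (?I\<^sup>2) = (\<integral>\<^sup>+t. ennreal (norm (f t)) * ennreal (norm (g t)) \<partial>lborel)\<^sup>2"
    using nn_integral_eq_integral[OF intfg] by (simp add: ennreal_power ennreal_mult)
  also have "\<dots> \<le> (\<integral>\<^sup>+t. (ennreal (norm (f t)))\<^sup>2 \<partial>lborel) * (\<integral>\<^sup>+t. (ennreal (norm (g t)))\<^sup>2 \<partial>lborel)"
    by (rule Cauchy_Schwarz_nn_integral) auto
  also have "\<dots> = ennreal ((LINT t|lborel. (norm (f t))\<^sup>2) * (LINT t|lborel. (norm (g t))\<^sup>2))"
    using nn_integral_eq_integral[OF int(1)] nn_integral_eq_integral[OF int(2)]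
    by (simp add: ennreal_power ennreal_mult)
  finally have "?I\<^sup>2 \<le> (LINT t|lborel. (norm (f t))\<^sup>2) * (LINT t|lborel. (norm (g t))\<^sup>2)"
    by (subst (asm) ennreal_le_iff) auto
  then have "?I \<le> sqrt (LINT t|lborel. (norm (f t))\<^sup>2) * sqrt (LINT t|lborel. (norm (g t))\<^sup>2)"
    by (simp add: real_le_rsqrt flip: real_sqrt_mult)
  moreover have "norm (LINT t|lborel. f t * g t) \<le> ?I"
    using integral_norm_bound[of lborel "\<lambda>t. f t * g t"] by (simp add: norm_mult)
  ultimately show ?thesis
    by linarith
qed

lemma unitary_L2_norm:
  assumes "unitary_L2 T" "f \<in> L2_space"
  shows "(LINT t|lborel. (norm (T f t))\<^sup>2) = (LINT t|lborel. (norm (f t))\<^sup>2)"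
proof -
  have "complex_of_real (LINT t|lborel. (norm (T f t))\<^sup>2)
      = complex_of_real (LINT t|lborel. (norm (f t))\<^sup>2)"
    using assms unfolding unitary_L2_def
    by (simp add: complex_norm_square del: of_real_power flip: integral_complex_of_real)
  then show ?thesis
    by (simp only: of_real_eq_iff)
qed

lemma L2_space_diff:
  assumes "f \<in> L2_space" "g \<in> L2_space"
  shows "(\<lambda>t. f t - g t) \<in> L2_space"
proof -
  have [measurable]: "f \<in> borel_measurable borel" "g \<in> borel_measurable borel"
    and int: "integrable lborel (\<lambda>t. (norm (f t))\<^sup>2)" "integrable lborel (\<lambda>t. (norm (g t))\<^sup>2)"
    using assms by (auto simp: L2_space_def)
  have "integrable lborel (\<lambda>t. (norm (f t - g t))\<^sup>2)"
  proof (rule Bochner_Integration.integrable_bound)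
    show "integrable lborel (\<lambda>t. 2 * (norm (f t))\<^sup>2 + 2 * (norm (g t))\<^sup>2)"
      using int by simp
    have "(norm (f t - g t))\<^sup>2 \<le> 2 * (norm (f t))\<^sup>2 + 2 * (norm (g t))\<^sup>2" for t
    proof -
      have "(norm (f t - g t))\<^sup>2 \<le> (norm (f t) + norm (g t))\<^sup>2"
        by (intro power_mono norm_triangle_ineq4) auto
      also have "\<dots> \<le> 2 * (norm (f t))\<^sup>2 + 2 * (norm (g t))\<^sup>2"
        using sum_squares_bound[of "norm (f t)" "norm (g t)"] by (simp add: power2_sum)
      finally show ?thesis .
    qed
    then show "AE t in lborel. norm ((norm (f t - g t))\<^sup>2)
        \<le> norm (2 * (norm (f t))\<^sup>2 + 2 * (norm (g t))\<^sup>2)"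
      by simp
  qed measurable
  then show ?thesis
    by (simp add: L2_space_def)
qed

text \<open>\<open>T\<close> is linear on representatives only up to null sets, so T f - T g is
  exchanged for T (f - g) under the integral, where the isometry applies.\<close>

lemma unitary_L2_dist:
  assumes T: "unitary_L2 T" and f: "f \<in> L2_space" and g: "g \<in> L2_space"
  shows "(LINT t|lborel. (norm (T f t - T g t))\<^sup>2) = (LINT t|lborel. (norm (f t - g t))\<^sup>2)"
proof -
  have T2: "T f \<in> L2_space" "T g \<in> L2_space" "T (\<lambda>t. f t - g t) \<in> L2_space"
    using T f g L2_space_diff[OF f g] by (auto simp: unitary_L2_def)
  then have [measurable]: "T f \<in> borel_measurable borel" "T g \<in> borel_measurable borel"
     "T (\<lambda>t. f t - g t) \<in> borel_measurable borel"
    by (auto simp: L2_space_def)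
  have "AE t in lborel. T (\<lambda>y. 1 * f y + (-1) * g y) t = 1 * T f t + (-1) * T g t"
    using T f g unfolding unitary_L2_def by blast
  then have "AE t in lborel. T (\<lambda>y. f y - g y) t = T f t - T g t"
    by simp
  then have "(LINT t|lborel. (norm (T (\<lambda>y. f y - g y) t))\<^sup>2) = (LINT t|lborel. (norm (T f t - T g t))\<^sup>2)"
    by (intro integral_cong_AE) auto
  then show ?thesis
    using unitary_L2_norm[OF T L2_space_diff[OF f g]] by simp
qed

text \<open>The product of two translates is exp (-(pi/2) |u - v|^2) times a narrower Gaussian at
  the midpoint, so expanding the square leaves an explicit function of u - v that tends to 0 with
  it.\<close>

lemma gaussian_translate_dist:
  fixes u v :: "'a::euclidean_space"
  shows "(LINT t|lborel. (norm (gaussian (t - u) - gaussian (t - v)))\<^sup>2)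
    = 2 * (1 - exp (- (pi / 2) * (norm (u - v))\<^sup>2)) * (LINT s|lborel. exp (- (2 * pi) * (norm (s::'a))\<^sup>2))"
    (is "_ = _ * ?c")
proof -
  define r where "r = (\<lambda>u t::'a. exp (- pi * (norm (t - u))\<^sup>2))"
  let ?e = "\<lambda>s::'a. exp (- (2 * pi) * (norm s)\<^sup>2)"
  have eq: "r u t * r v t = exp (- (pi / 2) * (norm (u - v))\<^sup>2) * ?e (- ((1/2) *\<^sub>R (u + v)) + t)"
    for u v t :: 'a
    unfolding r_def exp_add[symmetric] exp_inj_iff power2_norm_eq_inner
    by (simp add: inner_simps inner_commute field_simps)
  have int: "integrable lborel (\<lambda>t. r u t * r v t)" for u v :: 'a
    unfolding eq using integrable_lborel_translate[of ?e "- ((1/2) *\<^sub>R (u + v))"]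
      integrable_exp_neg_square_norm[of "2 * pi"] by simp
  have overlap: "(LINT t|lborel. r u t * r v t) = exp (- (pi / 2) * (norm (u - v))\<^sup>2) * ?c" for u v :: 'a
    unfolding eq using integral_lborel_translate[of ?e "- ((1/2) *\<^sub>R (u + v))"] by simp
  have "(norm (gaussian (t - u) - gaussian (t - v)))\<^sup>2
      = r u t * r u t + r v t * r v t - 2 * (r u t * r v t)" for t
    unfolding r_def gaussian_def of_real_diff[symmetric] norm_of_real
    by (simp add: power2_eq_square algebra_simps)
  then have "(LINT t|lborel. (norm (gaussian (t - u) - gaussian (t - v)))\<^sup>2)
      = (LINT t|lborel. r u t * r u t + r v t * r v t - 2 * (r u t * r v t))"
    by (simp only:)
  also have "\<dots> = (LINT t|lborel. r u t * r u t) + (LINT t|lborel. r v t * r v t)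
      - 2 * (LINT t|lborel. r u t * r v t)"
    by (simp add: int)
  also have "\<dots> = 2 * (1 - exp (- (pi / 2) * (norm (u - v))\<^sup>2)) * ?c"
    unfolding overlap by (simp add: algebra_simps)
  finally show ?thesis .
qed

text \<open>Moving the centre of a Gaussian is continuous in L^2, T preserves L^2 distances, and the
  pairing is controlled by Cauchy-Schwarz. The integral is therefore jointly continuous in both
  centres, phases included.\<close>

lemma continuous_gaussian_matrix_coefficient:
  assumes T: "unitary_L2 T"
  shows "continuous_on UNIV
    (\<lambda>(x, y). LINT t|lborel. T (\<lambda>t. gaussian (t - y)) t * gaussian (t - (x :: 'a::euclidean_space)))"
proof -
  define g where "g = (\<lambda>y t. gaussian (t - y :: 'a))"
  define N where "N = (\<lambda>f. sqrt (LINT t::'a|lborel. (norm (f t :: complex))\<^sup>2))"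
  define h where "h = (\<lambda>z. LINT t|lborel. T (g (snd z)) t * g (fst z) t)"
  have g: "g y \<in> L2_space" for y
    unfolding g_def by (rule gaussian_translate_in_L2_space)
  have Tg: "T (g y) \<in> L2_space" for y
    using T g by (auto simp: unitary_L2_def)
  have N0: "N (g y) = N (g 0)" for y
    unfolding N_def g_def using integral_lborel_translate[of "\<lambda>t. (norm (gaussian (t::'a)))\<^sup>2" "- y"] by simp
  define d where "d = (\<lambda>u v. N (\<lambda>t. g u t - g v t))"
  have d_tendsto: "((\<lambda>z. d (r z) (r z0)) \<longlongrightarrow> 0) (at z0)"
    if "(r \<longlongrightarrow> r z0) (at z0)" for r :: "'a \<times> 'a \<Rightarrow> 'a" and z0
  proof -
    have "((\<lambda>z. d (r z) (r z0)) \<longlongrightarrow> sqrt (2 * (1 - exp (- (pi / 2) * (norm (r z0 - r z0))\<^sup>2))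
        * (LINT s|lborel. exp (- (2 * pi) * (norm (s::'a))\<^sup>2)))) (at z0)"
      unfolding d_def N_def g_def gaussian_translate_dist by (intro tendsto_intros that)
    then show ?thesis
      by simp
  qed
  have NT: "N (T (g y)) = N (g 0)" for y
    using unitary_L2_norm[OF T g, of y] N0[of y] by (simp add: N_def)
  have dT: "N (\<lambda>t. T (g u) t - T (g v) t) = d u v" for u v
    using unitary_L2_dist[OF T g g] by (simp add: N_def d_def)
  have bound: "norm (h z - h z0) \<le> N (g 0) * d (fst z) (fst z0) + d (snd z) (snd z0) * N (g 0)" for z z0
  proof -
    \<comment> \<open>The two centres are moved one at a time. In each resulting integral one factor
      is small in L^2, and the other has the norm of the Gaussian at 0, by unitarity and translation
      invariance.\<close>
    have split: "h z - h z0 = (LINT t|lborel. T (g (snd z)) t * (g (fst z) t - g (fst z0) t))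
        + (LINT t|lborel. (T (g (snd z)) t - T (g (snd z0)) t) * g (fst z0) t)"
    proof -
      have i: "integrable lborel (\<lambda>t. T (g y) t * g x t)" for x y
        by (intro L2_space_mult_integrable g Tg)
      show ?thesis
        unfolding h_def right_diff_distrib left_diff_distrib
          Bochner_Integration.integral_diff[OF i i] by (simp only: diff_add_cancel add_diff_eq)
    qed
    have "norm (h z - h z0) \<le> N (T (g (snd z))) * d (fst z) (fst z0)
        + N (\<lambda>t. T (g (snd z)) t - T (g (snd z0)) t) * N (g (fst z0))"
      unfolding split N_def d_def
      by (intro norm_triangle_mono L2_space_Cauchy_Schwarz L2_space_diff g Tg)
    then show ?thesis
      by (simp only: NT dT N0[of "fst z0"])
  qed
  have "(h \<longlongrightarrow> h z0) (at z0)" for z0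
  proof -
    have "((\<lambda>z. N (g 0) * d (fst z) (fst z0) + d (snd z) (snd z0) * N (g 0)) \<longlongrightarrow>
        N (g 0) * 0 + 0 * N (g 0)) (at z0)"
      by (intro tendsto_intros d_tendsto)
    then have lim: "((\<lambda>z. N (g 0) * d (fst z) (fst z0) + d (snd z) (snd z0) * N (g 0)) \<longlongrightarrow> 0) (at z0)"
      by simp
    have "((\<lambda>z. h z - h z0) \<longlongrightarrow> 0) (at z0)"
      by (rule Lim_null_comparison[OF always_eventually lim]) (rule allI, rule bound)
    then show ?thesis
      by (simp add: LIM_zero_iff)
  qed
  then have "continuous_on UNIV h"
    by (simp add: continuous_on_def)
  then show ?thesis
    by (simp add: h_def g_def case_prod_unfold)
qed

subsection \<open>Metaplectic operators\<close>

text \<open>A vanishing integral of a nonnegative function would make it zero almost everywhere,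
  whereas an exponential has no zeros. This yields c > 0 and permits division by the normalising
  integrals.\<close>

lemma integral_exp_neg_square_norm_linear_pos:
  fixes J :: "'a::euclidean_space \<Rightarrow> 'b::euclidean_space"
  assumes "a > 0" "linear J" "inj J"
  shows "0 < (LINT z|lborel. exp (- a * (norm (J z))\<^sup>2))"
proof -
  have "(LINT z|lborel. exp (- a * (norm (J z))\<^sup>2)) \<noteq> 0"
    using integrable_exp_neg_square_norm_linear[OF assms]
    by (subst integral_nonneg_eq_0_iff_AE) (auto simp: trivial_limit_def[symmetric] ae_filter_eq_bot_iff)
  moreover have "0 \<le> (LINT z|lborel. exp (- a * (norm (J z))\<^sup>2))"
    by simp
  ultimately show ?thesis
    by linarith
qed

text \<open>In the left slot rho(S z) T f equals T rho(z) f almost everywhere; both slots then carry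
  T, which unitarity removes.\<close>

lemma ambiguity_metaplectic:
  assumes T: "metaplectic_operator A B C D T" and f: "f \<in> L2_space"
  shows "ambiguity (T f) (A *v p + B *v q) (C *v p + D *v q) = ambiguity f p q"
proof -
  have U: "unitary_L2 T"
    using T by (simp add: metaplectic_operator_def)
  let ?r = "schroedinger_rep (A *v p + B *v q) (C *v p + D *v q) 0 (T f)"
  have r: "schroedinger_rep p q 0 f \<in> L2_space"
    by (rule L2_space_schroedinger_rep[OF f])
  have Tf: "T f \<in> L2_space" "T (schroedinger_rep p q 0 f) \<in> L2_space"
    using U f r by (auto simp: unitary_L2_def)
  moreover have "?r \<in> L2_space"
    by (rule L2_space_schroedinger_rep[OF Tf(1)])
  ultimately have [measurable]: "T f \<in> borel_measurable borel" "?r \<in> borel_measurable borel"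
      "T (schroedinger_rep p q 0 f) \<in> borel_measurable borel"
    by (auto simp: L2_space_def)
  have "AE t in lborel. T (schroedinger_rep p q 0 f) t = ?r t"
    using T f by (simp add: metaplectic_operator_def)
  then have "ambiguity (T f) (A *v p + B *v q) (C *v p + D *v q)
      = (LINT t|lborel. T (schroedinger_rep p q 0 f) t * cnj (T f t))"
    unfolding ambiguity_def by (intro integral_cong_AE) auto
  also have "\<dots> = ambiguity f p q"
    using U f r unfolding unitary_L2_def ambiguity_def by blast
  finally show ?thesis .
qed

text \<open>For D = I the second relation is the symmetry of B, and the third, transposed, gives A.
  Inserting A into the first relation, both sides contain C^T B C, and cancelling it leaves the
  symmetry of C.\<close>

lemma symplectic_lower_right_one:
  fixes A B C :: "real^'n^'n"
  assumes "symplectic A B C (mat 1)"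
  shows "transpose B = B" "transpose C = C" "A = mat 1 + B ** C"
proof -
  show B: "transpose B = B"
    using assms by (simp add: symplectic_def transpose_mat)
  have "transpose A = mat 1 + transpose C ** B"
    using assms by (simp add: symplectic_def diff_eq_eq)
  then have "transpose (transpose A) = transpose (mat 1 + transpose C ** B)"
    by simp
  moreover have "transpose (X + Y) = transpose X + transpose Y" for X Y :: "real^'n^'n"
    by (simp add: transpose_def vec_eq_iff)
  ultimately show A: "A = mat 1 + B ** C"
    by (simp add: transpose_mat matrix_transpose_mul B)
  have "(X + Y) ** Z = X ** Z + Y ** Z" for X Y Z :: "real^'n^'n"
    by (simp add: matrix_matrix_mult_def vec_eq_iff distrib_right sum.distrib)
  then have "transpose A ** C = C + transpose C ** (B ** C)"
    using \<open>transpose A = mat 1 + transpose C ** B\<close>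
    by (simp add: matrix_mul_assoc)
  moreover have "transpose C ** A = transpose C + transpose C ** (B ** C)"
    by (simp add: A matrix_add_ldistrib)
  ultimately show "transpose C = C"
    using assms by (simp add: symplectic_def)
qed

lemma inner_symmetric_matrix:
  fixes M :: "real^'n^'n"
  assumes "transpose M = M"
  shows "(M *v x) \<bullet> y = x \<bullet> (M *v y)"
  using assms dot_lmul_matrix[of x M y] by (metis inner_commute transpose_matrix_vector)

text \<open>The map \<open>N\<close> is the inverse of J* J, which is invertible because J is
  injective. It rewrites an arbitrary linear phase u.z in the form that the Fourier integral of exp
  (-a |J z|^2) expects.\<close>

lemma linear_gram_inverse:
  fixes J :: "'a::euclidean_space \<Rightarrow> 'b::euclidean_space"
  assumes "linear J" "inj J"
  obtains N where "linear N" "\<And>u z. u \<bullet> z = J (N u) \<bullet> J z"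
proof -
  let ?M = "adjoint J \<circ> J"
  have lin: "linear ?M"
    using assms adjoint_linear linear_compose by blast
  have gram: "?M u \<bullet> z = J u \<bullet> J z" for u z
    using adjoint_works[OF assms(1), of z "J u"] by (simp add: inner_commute)
  have "u = 0" if "?M u = 0" for u
    using gram[of u u] that assms linear_injective_0 by fastforce
  then have "inj ?M"
    using lin linear_injective_0 by blast
  then obtain N where "linear N" "\<And>u. ?M (N u) = u"
    using linear_injective_isomorphism[OF lin] by blast
  with gram show thesis
    by (intro that[of N]) metis+
qed

text \<open>The Gaussian on the product space is a tensor product of Gaussians, and tensor products
  are the test functions on which the kernel is prescribed. Evenness of the Gaussian turns the
  reflected argument of the convolution into a translate.\<close>

lemma smoothed_schwartz_kernel:
  assumes "is_schwartz_kernel T k"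
  shows "smoothed_kernel k (x, y) = T (\<lambda>t. gaussian (t - y)) (\<lambda>t. gaussian (t - x))"
proof -
  have "(\<lambda>w. gaussian ((x, y) - w)) = (\<lambda>(s, t). gaussian (s - x) * gaussian (t - y))"
  proof
    fix w :: "'a \<times> 'a"
    obtain s t where w: "w = (s, t)"
      by fastforce
    have "(norm ((x, y) - w))\<^sup>2 = (norm (s - x))\<^sup>2 + (norm (t - y))\<^sup>2"
      by (simp add: w norm_prod_def norm_minus_commute)
    then show "gaussian ((x, y) - w) = (case w of (s, t) \<Rightarrow> gaussian (s - x) * gaussian (t - y))"
      by (simp add: w gaussian_def exp_add[symmetric] algebra_simps flip: of_real_mult)
  qed
  then show ?thesis
    using assms gaussian_translate_in_schwartz_space[of x] gaussian_translate_in_schwartz_space[of y]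
    by (auto simp: smoothed_kernel_def distribution_convolution_def is_schwartz_kernel_def)
qed

lemma diagonal_kernel_of_gaussian_bound:
  assumes "continuous_on UNIV h" "c > 0" "a > 0"
    and le: "\<And>x y. norm (h (x, y)) \<le> c * exp (- a * (norm (x - y))\<^sup>2)"
  shows "diagonal_kernel h"
  unfolding diagonal_kernel_def
proof (intro conjI allI impI)
  fix N :: nat
  define K where "K = c * (fact N * exp a / a ^ N)"
  have "norm (h (x, y)) \<le> K * japanese_bracket (x - y) powr (- real N)" for x y
  proof -
    let ?b = "japanese_bracket (x - y)" and ?e = "exp (- a * (norm (x - y))\<^sup>2)"
    have b: "?b \<ge> 1"
      by (rule japanese_bracket_ge_1)
    \<comment> \<open>The Gaussian bound is stated for even powers; as the bracket is at least 1,
      the exponent may be doubled.\<close>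
    have "?b ^ N * ?e \<le> ?b ^ (2 * N) * ?e"
      using b by (intro mult_right_mono power_increasing) auto
    also have "\<dots> \<le> fact N * exp a / a ^ N"
      using assms by (intro japanese_bracket_power_mult_exp_le)
    finally have "c * (?b ^ N * ?e) \<le> K"
      unfolding K_def using \<open>c > 0\<close> by (intro mult_left_mono) auto
    then have "c * ?e \<le> K / ?b ^ N"
      using b by (simp add: field_simps)
    moreover have "K / ?b ^ N = K * ?b powr (- real N)"
      using b by (simp add: powr_minus powr_realpow divide_inverse)
    ultimately show ?thesis
      using le[of x y] by linarith
  qed
  moreover have "K > 0"
    using assms by (simp add: K_def)
  ultimately show "\<exists>K>0. \<forall>x y. norm (h (x, y)) \<le> K * japanese_bracket (x - y) powr (- real N)"
    by blast
qed (rule assms)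

text \<open>\<open>L (x, y) \<bullet> z\<close> is the phase at \<open>z\<close> that comes from the centres \<open>x\<close>, \<open>y\<close> of the two Gaussians.
  In the proof, \<open>J z = (z, S\<inverse> z)\<close>.\<close>

lemma metaplectic_gaussian_coefficient:
  fixes A B C :: "real^'n^'n" and T :: "(real^'n \<Rightarrow> complex) \<Rightarrow> (real^'n \<Rightarrow> complex)"
  assumes S: "symplectic A B C (mat 1)" and T: "metaplectic_operator A B C (mat 1) T"
  defines "L \<equiv> (\<lambda>(x, y). (- (C *v y), y - x + B *v (C *v y)))"
  obtains c K :: real and W :: "(real^'n) \<times> (real^'n) \<Rightarrow> ((real^'n) \<times> (real^'n)) \<times> ((real^'n) \<times> (real^'n))"
    where "c > 0" "K > 0" "linear W" "\<And>z. L z = 0 \<Longrightarrow> W z = 0" "\<And>z. norm (L z) \<le> K * norm (W z)"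
      "\<And>x y. norm (LINT t|lborel. T (\<lambda>t. gaussian (t - y)) t * gaussian (t - x))
        = c * exp (- pi * (norm (W (x, y)))\<^sup>2)"
proof -
  note B = symplectic_lower_right_one(1)[OF S] and C = symplectic_lower_right_one(2)[OF S]
    and A = symplectic_lower_right_one(3)[OF S]
  \<comment> \<open>\<open>P\<close> and \<open>R\<close> are the components of S^-1 (p, q). The
    lower row C P + R = q gives \<open>R\<close>; inserted into the upper row (I + B C) P + B R = p,
    it leaves P + B q = p.\<close>
  define P where "P = (\<lambda>p q. p - B *v q)"
  define R where "R = (\<lambda>p q. q - C *v P p q)"
  define J where "J = (\<lambda>(p, q). ((p, q), (P p q, R p q)))"
  have inverse: "A *v P p q + B *v R p q = p" "C *v P p q + mat 1 *v R p q = q" for p q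
    by (simp_all add: A P_def R_def matrix_vector_mult_add_rdistrib matrix_vector_mult_diff_distrib
        matrix_vector_mul_assoc[symmetric])
  have J: "linear J" "inj J"
    by (auto intro!: linearI injI simp: J_def P_def R_def matrix_vector_right_distrib
        matrix_vector_mult_diff_distrib matrix_vector_mult_scaleR algebra_simps)
  have L: "linear L"
    by (auto intro!: linearI simp: L_def matrix_vector_right_distrib matrix_vector_mult_scaleR algebra_simps)
  obtain N where N: "linear N" "\<And>u z. u \<bullet> z = J (N u) \<bullet> J z"
    using linear_gram_inverse[OF J] by blast
  \<comment> \<open>|W z|^2 = L z . (J* J)^-1 L z: the dual of the Gram form of J, pulled back along
    \<open>L\<close>. This is the exponent that Fourier transformation produces.\<close>
  define W where "W = (\<lambda>z. J (N (L z)))"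
  have W: "linear W"
    unfolding W_def using linear_compose[OF linear_compose[OF L N(1)] J(1)] by (simp add: o_def)
  have W0: "W z = 0" if "L z = 0" for z
    unfolding W_def using that N(1) J(1) by (simp add: linear_0)
  obtain K where K: "K > 0" "\<And>z. norm (J z) \<le> K * norm z"
    using linear_bounded_pos[OF J(1)] by blast
  \<comment> \<open>By the choice of \<open>N\<close>, W z . J (L z) = |L z|^2, so an upper bound
    for J becomes a lower bound for W in terms of L.\<close>
  have LW: "norm (L z) \<le> K * norm (W z)" for z
  proof -
    have "norm (L z) * norm (L z) = W z \<bullet> J (L z)"
      unfolding W_def N(2)[symmetric] by (simp add: dot_square_norm power2_eq_square)
    also have "\<dots> \<le> norm (W z) * norm (J (L z))"
      by (rule norm_cauchy_schwarz)
    also have "\<dots> \<le> norm (W z) * (K * norm (L z))"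
      by (intro mult_left_mono K) simp
    finally have "norm (L z) * norm (L z) \<le> (K * norm (W z)) * norm (L z)"
      by (simp add: mult_ac)
    then show ?thesis
      using K(1) by (cases "norm (L z) = 0") (auto simp: mult_le_cancel_right)
  qed
  define c0 where "c0 = (LINT q|lborel. exp (- (pi / 2) * (norm (q :: real^'n))\<^sup>2))"
  define c1 where "c1 = (LINT s|lborel. exp (- (2 * pi) * (norm (s :: real^'n))\<^sup>2))"
  define I where "I = (LINT z|lborel. exp (- (pi / 2) * (norm (J z))\<^sup>2))"
  have pos: "c0 > 0" "c1 > 0" "I > 0"
    using integral_exp_neg_square_norm_linear_pos[of "pi / 2" "\<lambda>q::real^'n. q"]
      integral_exp_neg_square_norm_linear_pos[of "2 * pi" "\<lambda>q::real^'n. q"]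
      integral_exp_neg_square_norm_linear_pos[of "pi / 2" J] J linear_ident
    unfolding c0_def c1_def I_def by (simp_all add: inj_def)
  \<comment> \<open>The constant solves c0 |h|^2 = c1 I exp (-2 pi |W|^2) for |h|: \<open>c0\<close>
    comes from the Gaussian average, \<open>c1\<close> from the coefficients of a single Gaussian,
    and \<open>I\<close> is the total mass of the Gaussian built from J.\<close>
  define c where "c = sqrt (c1 * I / c0)"
  have main: "norm (LINT t|lborel. T (\<lambda>t. gaussian (t - y)) t * gaussian (t - x))
        = c * exp (- pi * (norm (W (x, y)))\<^sup>2)" (is "norm ?h = _") for x y
  proof -
    let ?g = "\<lambda>t. gaussian (t - y) :: complex"
    \<comment> \<open>The phase to be matched is 2 pi L (x, y) . z, while the Fourier integral with
      a = pi / 2 has pi (J w . J z); hence the factor 2. The transform is then exp (-2 pi |W (x,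
      y)|^2), the square of the claimed exponential.\<close>
    let ?w = "2 *\<^sub>R N (L (x, y))"
    define F where "F = (\<lambda>z. complex_of_real (exp (- (pi / 2) * (norm (J z))\<^sup>2))
      * exp (\<i> * (2 * (pi / 2) * (J ?w \<bullet> J z))))"
    have g: "?g \<in> L2_space"
      by (rule gaussian_translate_in_L2_space)
    then have Tg: "T ?g \<in> L2_space"
      using T by (auto simp: metaplectic_operator_def unitary_L2_def)
    have JL: "J ?w \<bullet> J z = 2 * (L (x, y) \<bullet> z)" for z
      using J(1) by (simp add: linear_scale N(2))
    have integrand: "exp (- (pi / 2) * ((norm p)\<^sup>2 + (norm q)\<^sup>2)) * exp (- 2 * pi * \<i> * (q \<bullet> x))
        * ambiguity (T ?g) p q = complex_of_real c1 * F (p, q)" for p q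
    proof -
      have ambiguity: "ambiguity (T ?g) p q = ambiguity ?g (P p q) (R p q)"
        using ambiguity_metaplectic[OF T g, of "P p q" "R p q"] by (simp only: inverse)
      have modulus: "complex_of_real (exp (- (pi / 2) * (norm (J (p, q)))\<^sup>2))
          = complex_of_real (exp (- (pi / 2) * ((norm p)\<^sup>2 + (norm q)\<^sup>2)))
            * complex_of_real (exp (- (pi / 2) * ((norm (P p q))\<^sup>2 + (norm (R p q))\<^sup>2)))"
        unfolding of_real_mult[symmetric] exp_add[symmetric] by (simp add: J_def norm_prod_def algebra_simps)
      have phase: "exp (\<i> * (2 * (pi / 2) * (J ?w \<bullet> J (p, q))))
          = exp (- 2 * pi * \<i> * (q \<bullet> x)) * exp (2 * pi * \<i> * (R p q \<bullet> y))"
      proof -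
        \<comment> \<open>The origin of \<open>L\<close>: the average contributes the frequency -x
          in q, the Gaussian at y contributes R . y, and the symmetry of B and C moves these
          matrices from p and q onto y.\<close>
        have "R p q \<bullet> y - q \<bullet> x = L (x, y) \<bullet> (p, q)"
        proof -
          have "R p q \<bullet> y = q \<bullet> y - (C *v p) \<bullet> y + (C *v (B *v q)) \<bullet> y"
            by (simp add: R_def P_def inner_diff_left matrix_vector_mult_diff_distrib)
          also have "\<dots> = q \<bullet> y - p \<bullet> (C *v y) + q \<bullet> (B *v (C *v y))"
            by (simp only: inner_symmetric_matrix[OF B] inner_symmetric_matrix[OF C])
          finally show ?thesis
            by (simp add: L_def inner_add_right inner_diff_right inner_commute[of _ q] inner_commute[of _ p])
        qed
        then have "complex_of_real (R p q \<bullet> y) = complex_of_real (q \<bullet> x) + complex_of_real (L (x, y) \<bullet> (p, q))"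
          by (simp add: algebra_simps flip: of_real_add)
        then show ?thesis
          unfolding exp_add[symmetric] JL by (intro arg_cong[of _ _ exp]) (simp add: algebra_simps)
      qed
      show ?thesis
        unfolding ambiguity ambiguity_gaussian F_def modulus phase c1_def by (simp only: mult_ac)
    qed
    have F_int: "integrable (lborel \<Otimes>\<^sub>M lborel) F"
      unfolding lborel_prod
    proof (rule Bochner_Integration.integrable_bound)
      show "integrable lborel (\<lambda>z. exp (- (pi / 2) * (norm (J z))\<^sup>2))"
        using J by (intro integrable_exp_neg_square_norm_linear) auto
      have [measurable]: "J \<in> borel_measurable borel"
        using J linear_continuous_on linear_linear borel_measurable_continuous_onI by blast
      show "F \<in> borel_measurable lborel"
        unfolding F_def by measurable
    qed (simp add: F_def norm_mult norm_exp_i_times)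
    have "complex_of_real (c0 * (norm ?h)\<^sup>2)
        = (LINT p|lborel. LINT q|lborel. complex_of_real c1 * F (p, q))"
      unfolding of_real_mult
      unfolding c0_def gaussian_average_ambiguity[OF Tg, of x, symmetric] integrand ..
    also have "\<dots> = c1 * (LINT p|lborel. LINT q|lborel. F (p, q))"
      by simp
    also have "\<dots> = c1 * (LINT z|lborel. F z)"
      using lborel_pair.integral_fst'[OF F_int] by (simp add: lborel_prod)
    also have "\<dots> = c1 * (exp (- (pi / 2) * (norm (J ?w))\<^sup>2) * I)"
      unfolding F_def I_def by (subst gaussian_fourier_integral) (use J in auto)
    also have "norm (J ?w) = 2 * norm (W (x, y))"
      unfolding W_def using J(1) by (simp add: linear_scale)
    finally have "c0 * (norm ?h)\<^sup>2 = c1 * (exp (- (pi / 2) * (2 * norm (W (x, y)))\<^sup>2) * I)"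
      by (simp only: of_real_eq_iff flip: of_real_mult)
    also have "exp (- (pi / 2) * (2 * norm (W (x, y)))\<^sup>2) = (exp (- pi * (norm (W (x, y)))\<^sup>2))\<^sup>2"
      by (simp add: exp_double[symmetric] power_mult_distrib)
    finally have "(norm ?h)\<^sup>2 = (c1 * I / c0) * (exp (- pi * (norm (W (x, y)))\<^sup>2))\<^sup>2"
      using pos by (simp add: field_simps)
    then have "sqrt ((norm ?h)\<^sup>2) = sqrt ((c1 * I / c0) * (exp (- pi * (norm (W (x, y)))\<^sup>2))\<^sup>2)"
      by simp
    then show ?thesis
      unfolding c_def real_sqrt_mult by simp
  qed
  show thesis
    by (rule that[OF _ K(1) W W0 LW main]) (use pos in \<open>simp add: c_def\<close>)
qed

theorem corollary3p3:
  fixes A B C D :: "real^'n^'n"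
    and T :: "(real^'n \<Rightarrow> complex) \<Rightarrow> (real^'n \<Rightarrow> complex)"
    and k :: "((real^'n) \<times> (real^'n) \<Rightarrow> complex) \<Rightarrow> complex"
  assumes "symplectic A B C D"
    and "metaplectic_operator A B C D T"
    and "is_schwartz_kernel (\<lambda>f. function_distribution (T f)) k"
    and "D = mat 1"
  shows "quasi_diagonal k \<and>
    (\<exists>c>0. \<exists>Q :: (real^'n) \<times> (real^'n) \<Rightarrow> real.
       psd_quadratic_form Q \<and>
       (\<forall>x y. norm (smoothed_kernel k (x, y)) = c * exp (- pi * Q (x, y))) \<and>
       {z. Q z = 0} = {(x, x) |x. C *v x = 0})"
proof -
  have S: "symplectic A B C (mat 1)" and T: "metaplectic_operator A B C (mat 1) T"
    using assms by auto
  define L where "L = (\<lambda>(x, y). (- (C *v y), y - x + B *v (C *v y)))"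
  obtain c K and W :: "(real^'n) \<times> (real^'n) \<Rightarrow> ((real^'n) \<times> (real^'n)) \<times> ((real^'n) \<times> (real^'n))"
    where c: "c > 0" and K: "K > 0" and W: "linear W" and LW0: "\<And>z. L z = 0 \<Longrightarrow> W z = 0"
      and LW: "\<And>z. norm (L z) \<le> K * norm (W z)"
      and coefficient: "\<And>x y. norm (LINT t|lborel. T (\<lambda>t. gaussian (t - y)) t * gaussian (t - x))
        = c * exp (- pi * (norm (W (x, y)))\<^sup>2)"
    using metaplectic_gaussian_coefficient[OF S T] unfolding L_def by blast
  define Q where "Q = (\<lambda>z. (norm (W z))\<^sup>2)"
  have kernel: "smoothed_kernel k (x, y)
      = (LINT t|lborel. T (\<lambda>t. gaussian (t - y)) t * gaussian (t - x))" for x y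
    using smoothed_schwartz_kernel[OF assms(3)] by (simp add: function_distribution_def)
  have "bilinear (\<lambda>u v. W u \<bullet> W v)"
    unfolding bilinear_def using W
    by (intro conjI allI linearI) (simp_all add: linear_add linear_scale inner_add_left inner_add_right)
  then have psd: "psd_quadratic_form Q"
    unfolding psd_quadratic_form_def quadratic_form_def
    by (auto simp: Q_def power2_norm_eq_inner)
  \<comment> \<open>The zero set of Q can thus be read off from \<open>L\<close>: once C y = 0, the
    term B (C y) drops out and the second component is y - x.\<close>
  have "W z = 0 \<longleftrightarrow> L z = 0" for z
    using LW0[of z] LW[of z] by auto
  then have zero: "{z. Q z = 0} = {(x, x) |x. C *v x = 0}"
    by (auto simp: Q_def L_def zero_prod_def)
  have "diagonal_kernel (smoothed_kernel k)"
  proof -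
    obtain M where M: "M > 0" "\<And>v. norm (B *v v) \<le> M * norm v"
      using linear_bounded_pos[OF matrix_vector_mul_linear] by blast
    \<comment> \<open>The two components of L (x, y) satisfy y - x = snd L + B (fst L), so |x - y|
      \<le> (1 + M) |L| \<le> (1 + M) K |W|.\<close>
    define e where "e = 1 / ((1 + M) * K)"
    have e: "e > 0"
      using M(1) K by (simp add: e_def)
    have eW: "e * norm (x - y) \<le> norm (W (x, y))" for x y
    proof -
      have "norm (x - y) \<le> norm (snd (L (x, y))) + norm (B *v (fst (L (x, y))))"
        using norm_triangle_ineq[of "snd (L (x, y))" "B *v (fst (L (x, y)))"]
        by (simp add: L_def norm_minus_commute linear_neg[OF matrix_vector_mul_linear])
      also have "\<dots> \<le> norm (L (x, y)) + M * norm (L (x, y))"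
        using M(1) by (intro add_mono order_trans[OF M(2)] mult_left_mono norm_fst_le norm_snd_le
            norm_snd_le[of "snd (L (x, y))" "fst (L (x, y))", simplified] norm_fst_le[of "fst (L (x, y))" "snd (L (x, y))", simplified]) auto
      also have "\<dots> = (1 + M) * norm (L (x, y))"
        by (simp add: algebra_simps)
      also have "\<dots> \<le> (1 + M) * (K * norm (W (x, y)))"
        using M(1) by (intro mult_left_mono LW) simp
      finally have "norm (x - y) \<le> norm (W (x, y)) * ((1 + M) * K)"
        by (simp only: mult_ac)
      then show ?thesis
        using M(1) K by (simp add: e_def pos_divide_le_eq)
    qed
    have "norm (smoothed_kernel k (x, y)) \<le> c * exp (- (pi * e\<^sup>2) * (norm (x - y))\<^sup>2)" for x y
    proof -
      have "(e * norm (x - y))\<^sup>2 \<le> (norm (W (x, y)))\<^sup>2"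
        using e eW by (intro power_mono) auto
      then show ?thesis
        unfolding kernel coefficient using c by (simp add: power_mult_distrib)
    qed
    moreover have "continuous_on UNIV (smoothed_kernel k)"
      using continuous_gaussian_matrix_coefficient[of T] T
      by (simp add: metaplectic_operator_def kernel[symmetric])
    ultimately show ?thesis
      using c e by (intro diagonal_kernel_of_gaussian_bound[where c = c and a = "pi * e\<^sup>2"]) auto
  qed
  then have "quasi_diagonal k"
    using assms(3) by (simp add: quasi_diagonal_def is_schwartz_kernel_def)
  moreover have "\<forall>x y. norm (smoothed_kernel k (x, y)) = c * exp (- pi * Q (x, y))"
    by (simp only: kernel coefficient Q_def) simp
  ultimately show ?thesis
    using c psd zero by blast
qed

end
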